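(* Let $f:\mathbb{R}^n\to\mathbb{R}^n$ be a convex monotone homogeneous map that has an eigenvector. Let $C=N^{c}(f)$ be the set of critical nodes of $f$, let $c=\mathsf{c}(f)$ be the cyclicity of $f$, let $\lambda$ be the unique eigenvalue of $f$, and let $\mathscr{E}(f)=\{x\in\mathbb{R}^n \mid f(x)=\lambda+x\}$. Then: (1) the restriction $\mathsf{r}:\mathbb{R}^n\to\mathbb{R}^C$, $x\mapsto (x_i)_{i\in C}$, is a monotone homogeneous isomorphism from $\mathscr{E}(f)$ to its image $\mathscr{E}^{c}(f)=\mathsf{r}(\mathscr{E}(f))$; (2) $\mathscr{E}^{c}(f)$ is an inf-subsemilattice of $(\mathbb{R}^C,\leq)$; (3) $\mathscr{E}^{c}(f)$ is a convex set whose dimension is at most equal to the number of critical classes of $f$, and this bound is attained when $f$ is piecewise affine; (4) for all $x\in\mathbb{R}^n$, $f^{kc}(x)-kc\lambda$ has a limit when $k\to\infty$.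
   Context: $\leq$ is the product (entrywise) order of $\mathbb{R}^n$. For $\lambda\in\mathbb{R}$, $x\in\mathbb{R}^n$, $\lambda+x=(\lambda+x_1,\dots,\lambda+x_n)$ (and $x-\lambda$ similarly). A map $f$ is monotone if $x\le y\Rightarrow f(x)\le f(y)$, (additively) homogeneous if $f(\lambda+x)=\lambda+f(x)$ for all $\lambda\in\mathbb{R}$, and convex if each coordinate $f_i$ is convex. An eigenvector of $f$ is $v\in\mathbb{R}^n$ with $f(v)=\lambda+v$ for some $\lambda\in\mathbb{R}$, the eigenvalue (it is unique when $f$ is monotone homogeneous and has an eigenvector). $f^k$ is the $k$-th iterate. A monotone homogeneous map $g:U\subset\mathbb{R}^n\to V\subset\mathbb{R}^p$ (monotonicity and homogeneity being required for points of $U$) is a monotone homogeneous isomorphism if it has a monotone homogeneous inverse $V\to U$. An inf-subsemilattice of $\mathbb{R}^C$ is a subset stable under entrywise minimum. The dimension of a convex set is the dimension of its affine hull. $f$ is piecewise affine if $\mathbb{R}^n$ can be covered by finitely many polyhedra (finite intersections of half-spaces) on each of which $f$ is affine. Critical graph: $\partial f(v)=\{P\in\mathbb{R}^{n\times n}\mid f(x)-f(v)\ge P(x-v)\ \forall x\in\mathbb{R}^n\}$; for $f$ convex monotone homogeneous its elements are (row-)stochastic matrices. For a stochastic matrix $P$, $\mathscr{G}(P)$ is the directed graph on $\{1,\dots,n\}$ with arcs $i\to j$ when $P_{ij}\ne0$; classes of a graph are its equivalence classes for mutual accessibility (each node has access to itself), and a class is final if no node in it has access to a node outside it. The final graph $\mathscr{G}^{f}(P)$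 is the restriction of $\mathscr{G}(P)$ to the union of the final classes of $P$ (i.e. the union of the graphs $\mathscr{G}(P_{FF})$, $F$ a final class). If $v$ is an eigenvector of $f$, the critical graph is $\mathscr{G}^{c}(f)=\bigcup_{P\in\partial f(v)}\mathscr{G}^{f}(P)$ (union of node sets and of arc sets); it does not depend on the choice of $v$. $N^{c}(f)$ is its set of nodes; the critical classes of $f$ are the node sets of the strongly connected components $\mathscr{G}_1,\dots,\mathscr{G}_s$ of $\mathscr{G}^{c}(f)$. The cyclicity $\mathsf{c}(\mathscr{G}_i)$ is the gcd of the lengths of the circuits of $\mathscr{G}_i$, and $\mathsf{c}(f)=\mathrm{lcm}(\mathsf{c}(\mathscr{G}_1),\dots,\mathsf{c}(\mathscr{G}_s))$. *)

theory Defs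
  imports "HOL-Analysis.Analysis"
begin

section \<open>Monotone homogeneous maps\<close>

text \<open>For a set \<open>C\<close> of coordinates, \<open>\<real>\<^sup>C\<close> is realised inside \<open>real ^ 'n\<close> as the vectors that vanish
  outside \<open>C\<close>; its order, convexity, minimum and affine dimension are then the ones inherited from
  \<open>real ^ 'n\<close>. Adding a scalar to a point of \<open>\<real>\<^sup>C\<close>, however, must leave the padding zeros alone,
  whence \<open>add_scalar\<close>. For \<open>C = UNIV\<close> these are \<open>\<real>\<^sup>n\<close> and \<open>vec c + x\<close>.\<close>

definition coord_space :: "'n set \<Rightarrow> (real ^ 'n::finite) set" where
  "coord_space C = {x. \<forall>i. i \<notin> C \<longrightarrow> x $ i = 0}"

definition restriction :: "'n set \<Rightarrow> real ^ 'n::finite \<Rightarrow> real ^ 'n" where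
  "restriction C x = (\<chi> i. if i \<in> C then x $ i else 0)"

definition add_scalar :: "'n set \<Rightarrow> real \<Rightarrow> real ^ 'n::finite \<Rightarrow> real ^ 'n" where
  "add_scalar C c x = (\<chi> i. if i \<in> C then c + x $ i else 0)"

lemma coord_space_UNIV: "coord_space UNIV = UNIV"
  by (simp add: coord_space_def)

lemma restriction_mem: "restriction C x \<in> coord_space C"
  by (simp add: coord_space_def restriction_def)

lemma add_scalar_UNIV: "add_scalar UNIV c x = vec c + x"
  by (simp add: add_scalar_def vec_eq_iff)

definition homogeneous :: "(real ^ 'n::finite \<Rightarrow> real ^ 'n) \<Rightarrow> bool" where
  "homogeneous f \<longleftrightarrow> (\<forall>c x. f (vec c + x) = vec c + f x)"

definition monotone_homogeneous_on ::
  "'n set \<Rightarrow> 'm set \<Rightarrow> (real ^ 'n::finite) set \<Rightarrow> (real ^ 'n \<Rightarrow> real ^ 'm::finite) \<Rightarrow> bool" where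
  "monotone_homogeneous_on I J U g \<longleftrightarrow>
     mono_on U g \<and>
     (\<forall>x\<in>U. \<forall>c. add_scalar I c x \<in> U \<longrightarrow> g (add_scalar I c x) = add_scalar J c (g x))"

definition monotone_homogeneous_iso ::
  "'n set \<Rightarrow> 'm set \<Rightarrow> (real ^ 'n::finite) set \<Rightarrow> (real ^ 'm::finite) set \<Rightarrow>
     (real ^ 'n \<Rightarrow> real ^ 'm) \<Rightarrow> bool" where
  "monotone_homogeneous_iso I J U V g \<longleftrightarrow>
     U \<subseteq> coord_space I \<and> V \<subseteq> coord_space J \<and>
     g ` U \<subseteq> V \<and> monotone_homogeneous_on I J U g \<and>
     (\<exists>h. h ` V \<subseteq> U \<and> monotone_homogeneous_on J I V h \<and>
          (\<forall>x\<in>U. h (g x) = x) \<and> (\<forall>y\<in>V. g (h y) = y))"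

definition inf_subsemilattice :: "'n set \<Rightarrow> (real ^ 'n::finite) set \<Rightarrow> bool" where
  "inf_subsemilattice C S \<longleftrightarrow> S \<subseteq> coord_space C \<and> (\<forall>x\<in>S. \<forall>y\<in>S. inf x y \<in> S)"

definition convex_map :: "(real ^ 'n::finite \<Rightarrow> real ^ 'm::finite) \<Rightarrow> bool" where
  "convex_map f \<longleftrightarrow> (\<forall>i. convex_on UNIV (\<lambda>x. f x $ i))"

definition piecewise_affine :: "(real ^ 'n::finite \<Rightarrow> real ^ 'm::finite) \<Rightarrow> bool" where
  "piecewise_affine f \<longleftrightarrow>
     (\<exists>\<P>. finite \<P> \<and> \<Union>\<P> = UNIV \<and>
          (\<forall>S\<in>\<P>. polyhedron S \<and> (\<exists>A b. \<forall>x\<in>S. f x = A *v x + b)))"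

definition eigenspace :: "(real ^ 'n::finite \<Rightarrow> real ^ 'n) \<Rightarrow> real \<Rightarrow> (real ^ 'n) set" where
  "eigenspace f lam = {x. f x = vec lam + x}"

lemma eigenvalue_le:
  fixes f :: "real ^ 'n::finite \<Rightarrow> real ^ 'n"
  assumes "mono f" "homogeneous f" "v \<in> eigenspace f lam" "w \<in> eigenspace f mu"
  shows "lam \<le> mu"
proof -
  have "Max (range (\<lambda>j. v $ j - w $ j)) \<in> range (\<lambda>j. v $ j - w $ j)"
    by (rule Max_in) auto
  then obtain i where "Max (range (\<lambda>j. v $ j - w $ j)) = v $ i - w $ i" by blast
  then have i: "v $ j - w $ j \<le> v $ i - w $ i" for j
    using Max_ge[of "range (\<lambda>j. v $ j - w $ j)" "v $ j - w $ j"] by simp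
  define t where "t = v $ i - w $ i"
  have "v \<le> vec t + w"
    using i by (simp add: less_eq_vec_def t_def diff_le_eq)
  then have "f v \<le> f (vec t + w)"
    using assms(1) by (simp add: mono_def)
  then have "vec lam + v \<le> vec t + (vec mu + w)"
    using assms by (simp add: homogeneous_def eigenspace_def)
  then have "lam + v $ i \<le> t + (mu + w $ i)"
    by (simp add: less_eq_vec_def)
  then show ?thesis by (simp add: t_def)
qed

lemma eigenvalue_unique:
  fixes f :: "real ^ 'n::finite \<Rightarrow> real ^ 'n"
  assumes "mono f" "homogeneous f" "v \<in> eigenspace f lam" "w \<in> eigenspace f mu"
  shows "lam = mu"
  using eigenvalue_le[OF assms] eigenvalue_le[OF assms(1,2,4,3)] by simp

section \<open>Graphs\<close>

text \<open>A directed graph is a node set \<open>N\<close> together with an arc relation \<open>E \<subseteq> N \<times> N\<close>.\<close>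

definition graph_classes :: "'a set \<Rightarrow> 'a rel \<Rightarrow> 'a set set" where
  "graph_classes N E = N // {(i, j) \<in> N \<times> N. (i, j) \<in> E\<^sup>* \<and> (j, i) \<in> E\<^sup>*}"

definition final_classes :: "'a set \<Rightarrow> 'a rel \<Rightarrow> 'a set set" where
  "final_classes N E = {F \<in> graph_classes N E. \<forall>i\<in>F. \<forall>j. (i, j) \<in> E\<^sup>* \<longrightarrow> j \<in> F}"

text \<open>A circuit is a closed path of positive length, so \<open>K\<close> carries a circuit of length \<open>k\<close> through \<open>i\<close>
  iff \<open>(i, i)\<close> belongs to the \<open>k\<close>-th power of the arc relation restricted to \<open>K\<close>.\<close>

definition class_cyclicity :: "'a rel \<Rightarrow> 'a set \<Rightarrow> nat" where
  "class_cyclicity E K = Gcd {k. k > 0 \<and> (\<exists>i\<in>K. (i, i) \<in> (E \<inter> K \<times> K) ^^ k)}"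

definition graph_cyclicity :: "'a set \<Rightarrow> 'a rel \<Rightarrow> nat" where
  "graph_cyclicity N E = Lcm (class_cyclicity E ` graph_classes N E)"

definition matrix_graph :: "real ^ 'n ^ 'n::finite \<Rightarrow> 'n rel" where
  "matrix_graph P = {(i, j). P $ i $ j \<noteq> 0}"

definition final_nodes :: "real ^ 'n ^ 'n::finite \<Rightarrow> 'n set" where
  "final_nodes P = \<Union>(final_classes UNIV (matrix_graph P))"

definition final_arcs :: "real ^ 'n ^ 'n::finite \<Rightarrow> 'n rel" where
  "final_arcs P = matrix_graph P \<inter> final_nodes P \<times> final_nodes P"

section \<open>The critical graph\<close>

definition subdifferential ::
  "(real ^ 'n::finite \<Rightarrow> real ^ 'n) \<Rightarrow> real ^ 'n \<Rightarrow> (real ^ 'n ^ 'n) set" where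
  "subdifferential f v = {P. \<forall>x. P *v (x - v) \<le> f x - f v}"

text \<open>The critical graph is formed at an eigenvector \<open>v\<close> of \<open>f\<close>. Since it is the same at every
  eigenvector, \<open>v\<close> is kept as an argument rather than picked by a choice operator.\<close>

definition critical_nodes :: "(real ^ 'n::finite \<Rightarrow> real ^ 'n) \<Rightarrow> real ^ 'n \<Rightarrow> 'n set" where
  "critical_nodes f v = (\<Union>P\<in>subdifferential f v. final_nodes P)"

definition critical_arcs :: "(real ^ 'n::finite \<Rightarrow> real ^ 'n) \<Rightarrow> real ^ 'n \<Rightarrow> 'n rel" where
  "critical_arcs f v = (\<Union>P\<in>subdifferential f v. final_arcs P)"

definition critical_classes :: "(real ^ 'n::finite \<Rightarrow> real ^ 'n) \<Rightarrow> real ^ 'n \<Rightarrow> 'n set set" where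
  "critical_classes f v = graph_classes (critical_nodes f v) (critical_arcs f v)"

definition cyclicity :: "(real ^ 'n::finite \<Rightarrow> real ^ 'n) \<Rightarrow> real ^ 'n \<Rightarrow> nat" where
  "cyclicity f v = graph_cyclicity (critical_nodes f v) (critical_arcs f v)"

end

theory Submission
  imports Defs
begin

text \<open>After subtracting the eigenvalue, eigenvectors are fixed points. A maximum principle drives the
  proof: if two orbits that can be continued backwards keep a maximal gap, midpoint subgradients
  produce a closed set of coordinates, hence a critical node at which the gap is attained; so fixed
  points are ordered by their critical coordinates. If \<open>f(w) \<le> w\<close>, then \<open>f\<^sup>k(w)\<close> decreases to a fixed
  point without changing the critical coordinates, and such \<open>w\<close> form a convex set closed under
  minimum, on which \<open>w - v\<close> is constant on critical classes. In the piecewise affine case, Farkas'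
  lemma yields \<open>w\<close> that satisfies strictly all the active affine inequalities not carried by critical
  arcs, so \<open>w\<close> may be perturbed freely on each critical class. Finally, on the limit set of an orbit
  the critical coordinates evolve linearly, hence with period the cyclicity, and the maximum principle
  extends this period to all coordinates.\<close>

section \<open>Subgradients and stochastic vectors\<close>

text \<open>The fixed points themselves are in general neither convex nor closed under minimum: for
  \<open>f(x) = (x1, x2, max(x1, x2))\<close> they are the points \<open>(a, b, max(a, b))\<close>.
  The vectors with \<open>f(w) <= w\<close> have both properties and the same restrictions to the
  critical nodes, which is why they replace fixed points. The main obstacle is that the critical
  graph only sees subgradients at \<open>v\<close>, whereas a gap between two other points is
  controlled by subgradients elsewhere. A subgradient can be moved to \<open>v\<close> when its
  affine minorant also touches the map there, and a second maximisation, of the distance to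
  \<open>v\<close>, secures this. Moreover a stochastic row expresses a coordinate of an image by an
  average over coordinates of the preimage, so extremal values travel backwards in time; this is why
  backward orbits and limit sets appear. Finally, different critical arcs may come from different
  matrices, so the periodicity argument follows paths arc by arc, each with its own matrix.\<close>

definition subgradient :: "('a::real_inner \<Rightarrow> real) \<Rightarrow> 'a \<Rightarrow> 'a \<Rightarrow> bool" where
  "subgradient h x q \<longleftrightarrow> (\<forall>y. q \<bullet> (y - x) \<le> h y - h x)"

text \<open>Separates the strict epigraph, recentred at \<open>(x, h x)\<close>, from the origin.
  The hyperplane cannot be vertical: \<open>h\<close> is finite everywhere, so the epigraph has
  points over every direction, in particular over \<open>- p\<close>.\<close>

lemma subgradient_exists:
  fixes h :: "'a::euclidean_space \<Rightarrow> real"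
  assumes "convex_on UNIV h"
  obtains q where "subgradient h x q"
proof -
  define S where "S = {z :: 'a \<times> real. h (x + fst z) - h x < snd z}"
  have "convex S"
  proof (rule convexI)
    fix y z :: "'a \<times> real" and s t :: real
    assume y: "y \<in> S" and z: "z \<in> S" and st: "0 \<le> s" "0 \<le> t" "s + t = 1"
    have *: "x + fst (s *\<^sub>R y + t *\<^sub>R z) = s *\<^sub>R (x + fst y) + t *\<^sub>R (x + fst z)"
      using st by (simp add: algebra_simps flip: scaleR_left_distrib)
    have "h (x + fst (s *\<^sub>R y + t *\<^sub>R z)) \<le> s * h (x + fst y) + t * h (x + fst z)"
      unfolding * using assms st by (simp add: convex_on_def)
    also have "\<dots> < s * (snd y + h x) + t * (snd z + h x)"
    proof (cases "s = 0")
      case False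
      then have "s * h (x + fst y) < s * (snd y + h x)" "t * h (x + fst z) \<le> t * (snd z + h x)"
        using y z st by (auto simp: S_def intro!: mult_left_mono)
      then show ?thesis by simp
    qed (use z st in \<open>auto simp: S_def\<close>)
    also have "\<dots> = snd (s *\<^sub>R y + t *\<^sub>R z) + (s + t) * h x"
      by (simp add: algebra_simps)
    finally show "s *\<^sub>R y + t *\<^sub>R z \<in> S"
      using st by (simp add: S_def)
  qed
  moreover have "0 \<notin> S" by (simp add: S_def)
  ultimately obtain a where a: "a \<noteq> 0" "\<And>z. z \<in> S \<Longrightarrow> 0 \<le> a \<bullet> z"
    using separating_hyperplane_set_0[of S] by metis
  define p b where "p = fst a" and "b = snd a"
  have pb: "0 \<le> p \<bullet> y + b * s" if "h (x + y) - h x < s" for y s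
    using a(2)[of "(y, s)"] that by (simp add: S_def p_def b_def inner_prod_def)
  have "0 \<le> b" using pb[of 0 1] by simp
  have "b \<noteq> 0"
  proof
    assume "b = 0"
    then have "0 \<le> p \<bullet> (- p)" using pb[of "- p" "h (x + - p) - h x + 1"] by simp
    then have "p = 0" by (metis inner_ge_zero inner_minus_right inner_eq_zero_iff neg_0_le_iff_le order_antisym)
    with \<open>b = 0\<close> a(1) show False by (simp add: p_def b_def prod_eq_iff)
  qed
  with \<open>0 \<le> b\<close> have "0 < b" by simp
  have "(- (1 / b) *\<^sub>R p) \<bullet> (y - x) \<le> h y - h x" for y
  proof -
    have "0 \<le> p \<bullet> (y - x) + b * (h y - h x)"
    proof (rule field_le_epsilon)
      fix e :: real assume "0 < e"
      then show "0 \<le> p \<bullet> (y - x) + b * (h y - h x) + e"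
        using pb[of "y - x" "h y - h x + e / b"] \<open>0 < b\<close> by (simp add: algebra_simps)
    qed
    then show ?thesis using \<open>0 < b\<close> by (simp add: field_simps)
  qed
  then have "subgradient h x (- (1 / b) *\<^sub>R p)" unfolding subgradient_def by blast
  then show ?thesis by (rule that)
qed

text \<open>Being a subgradient at \<open>b\<close> already gives the reverse inequality, so the
  affine minorant touching \<open>h\<close> at \<open>b\<close> also touches it at \<open>v\<close>,
  and therefore supports \<open>h\<close> there.\<close>

lemma subgradient_transfer:
  assumes "subgradient h b q" "q \<bullet> (b - v) \<le> h b - h v"
  shows "subgradient h v q"
proof -
  have "q \<bullet> (y - v) = q \<bullet> (y - b) + q \<bullet> (b - v)" for y
    by (simp add: inner_diff_right)
  then show ?thesis
    using assms by (smt (verit) subgradient_def)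
qed

lemma mem_subdifferential_iff:
  "P \<in> subdifferential f v \<longleftrightarrow> (\<forall>i. subgradient (\<lambda>x. f x $ i) v (P $ i))"
  by (auto simp: subdifferential_def subgradient_def less_eq_vec_def matrix_vector_mul_component)

definition stochastic :: "real ^ 'n::finite \<Rightarrow> bool" where
  "stochastic q \<longleftrightarrow> (\<forall>j. 0 \<le> q $ j) \<and> (\<Sum>j\<in>(UNIV::'n set). q $ j) = 1"

text \<open>Equality case for an average of the nonnegative gaps \<open>s - z $ j\<close>. The bound
  is asked only on the support because some applications know it only there.\<close>

lemma stochastic_inner_eq_max:
  assumes q: "stochastic q" and le: "\<And>j. q $ j \<noteq> 0 \<Longrightarrow> z $ j \<le> s"
    and s: "s \<le> q \<bullet> z" and j: "q $ j \<noteq> 0"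
  shows "z $ j = s"
proof -
  have "(\<Sum>j\<in>UNIV. q $ j * (s - z $ j)) = s - q \<bullet> z"
    using q by (simp add: stochastic_def inner_vec_def right_diff_distrib sum_subtractf
        flip: sum_distrib_right)
  moreover have nn: "0 \<le> q $ j * (s - z $ j)" for j
    using q le[of j] by (cases "q $ j = 0") (auto simp: stochastic_def)
  ultimately have "(\<Sum>j\<in>UNIV. q $ j * (s - z $ j)) = 0"
    using s sum_nonneg[of UNIV "\<lambda>j. q $ j * (s - z $ j)"] nn by simp
  then have "q $ j * (s - z $ j) = 0"
    using nn by (subst (asm) sum_nonneg_eq_0_iff) auto
  then show ?thesis using j by simp
qed

lemma stochastic_inner_const:
  assumes "stochastic q" "\<And>j. q $ j \<noteq> 0 \<Longrightarrow> z $ j = s"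
  shows "q \<bullet> z = s"
proof -
  have "q \<bullet> z = (\<Sum>j\<in>UNIV. q $ j * s)"
    unfolding inner_vec_def inner_real_def using assms(2) by (intro sum.cong) (auto)
  then show ?thesis using assms(1) by (simp add: stochastic_def flip: sum_distrib_right)
qed

lemma stochastic_inner_le:
  assumes "stochastic q" "\<And>j. z $ j \<le> s"
  shows "q \<bullet> z \<le> s"
proof -
  have "q \<bullet> z \<le> (\<Sum>j\<in>UNIV. q $ j * s)"
    unfolding inner_vec_def inner_real_def using assms by (intro sum_mono mult_left_mono) (auto simp: stochastic_def)
  then show ?thesis using assms(1) by (simp add: stochastic_def flip: sum_distrib_right)
qed

section \<open>Final nodes and stationary vectors\<close>

lemma mem_final_nodes_iff:
  "i \<in> final_nodes P \<longleftrightarrow>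
    (\<forall>j. (i, j) \<in> (matrix_graph P)\<^sup>* \<longrightarrow> (j, i) \<in> (matrix_graph P)\<^sup>*)"
proof
  let ?R = "(matrix_graph P)\<^sup>*"
  assume "i \<in> final_nodes P"
  then obtain F where F: "F \<in> final_classes UNIV (matrix_graph P)" "i \<in> F"
    by (auto simp: final_nodes_def)
  then obtain k where k: "F = {j. (k, j) \<in> ?R \<and> (j, k) \<in> ?R}"
    by (auto simp: final_classes_def graph_classes_def quotient_def)
  show "\<forall>j. (i, j) \<in> ?R \<longrightarrow> (j, i) \<in> ?R"
  proof (intro allI impI)
    fix j assume "(i, j) \<in> ?R"
    with F have "j \<in> F" by (auto simp: final_classes_def)
    then have "(j, k) \<in> ?R" using k by blast
    moreover have "(k, i) \<in> ?R" using F(2) k by blast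
    ultimately show "(j, i) \<in> ?R" by (rule rtrancl_trans)
  qed
next
  assume R: "\<forall>j. (i, j) \<in> (matrix_graph P)\<^sup>* \<longrightarrow> (j, i) \<in> (matrix_graph P)\<^sup>*"
  let ?F = "{j. (i, j) \<in> (matrix_graph P)\<^sup>* \<and> (j, i) \<in> (matrix_graph P)\<^sup>*}"
  have "?F \<in> graph_classes UNIV (matrix_graph P)"
    by (auto simp: graph_classes_def quotient_def)
  moreover have "\<forall>k\<in>?F. \<forall>j. (k, j) \<in> (matrix_graph P)\<^sup>* \<longrightarrow> j \<in> ?F"
    using R by (auto intro: rtrancl_trans)
  ultimately have "?F \<in> final_classes UNIV (matrix_graph P)"
    unfolding final_classes_def by (intro CollectI conjI)
  then show "i \<in> final_nodes P"
    unfolding final_nodes_def by (rule UnionI) simp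
qed

text \<open>Successors of a final node are final, so testing the tail of the arc is enough.\<close>

lemma mem_final_arcs_iff:
  "(i, j) \<in> final_arcs P \<longleftrightarrow> i \<in> final_nodes P \<and> P $ i $ j \<noteq> 0"
proof -
  have "j \<in> final_nodes P" if "i \<in> final_nodes P" "(i, j) \<in> matrix_graph P"
    using that unfolding mem_final_nodes_iff by (meson converse_rtrancl_into_rtrancl r_into_rtrancl rtrancl_trans)
  then show ?thesis by (auto simp: final_arcs_def matrix_graph_def)
qed

lemma closed_set_rtrancl:
  assumes "\<And>i j. i \<in> A \<Longrightarrow> (i, j) \<in> E \<Longrightarrow> j \<in> A" and "(i, j) \<in> E\<^sup>*" "i \<in> A"
  shows "j \<in> A"
  using assms(2,3) by (induction rule: rtrancl_induct) (auto intro: assms(1))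

text \<open>A node of \<open>A\<close> with the fewest reachable nodes is final: whatever it reaches
  stays in \<open>A\<close>, reaches no fewer nodes, and so must reach it back.\<close>

lemma closed_set_meets_final_nodes:
  fixes P :: "real ^ 'n::finite ^ 'n"
  assumes "A \<noteq> {}" and closed: "\<And>i j. i \<in> A \<Longrightarrow> P $ i $ j \<noteq> 0 \<Longrightarrow> j \<in> A"
  shows "A \<inter> final_nodes P \<noteq> {}"
proof -
  let ?E = "matrix_graph P"
  obtain i where "i \<in> A" and min: "\<And>j. j \<in> A \<Longrightarrow> card (?E\<^sup>* `` {i}) \<le> card (?E\<^sup>* `` {j})"
    using ex_has_least_nat[of "\<lambda>i. i \<in> A" _ "\<lambda>i. card (?E\<^sup>* `` {i})"] assms(1) by blast
  have "(j, i) \<in> ?E\<^sup>*" if ij: "(i, j) \<in> ?E\<^sup>*" for j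
  proof -
    have "j \<in> A"
      using closed_set_rtrancl[of A ?E i j] closed ij \<open>i \<in> A\<close> by (auto simp: matrix_graph_def)
    then have "card (?E\<^sup>* `` {i}) \<le> card (?E\<^sup>* `` {j})" by (rule min)
    moreover have "?E\<^sup>* `` {j} \<subseteq> ?E\<^sup>* `` {i}" using ij by auto
    ultimately have "?E\<^sup>* `` {j} = ?E\<^sup>* `` {i}"
      by (metis card_seteq finite)
    then show ?thesis by auto
  qed
  then have "i \<in> final_nodes P" by (simp add: mem_final_nodes_iff)
  with \<open>i \<in> A\<close> show ?thesis by blast
qed

text \<open>Mass balance on the closed set \<open>A\<close> of nodes reachable from
  \<open>j\<close>: its rows keep all their mass inside, so stationarity leaves no inflow from
  outside. Since \<open>m\<close> stays positive along the path from \<open>i\<close>, the node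
  \<open>i\<close> itself lies in \<open>A\<close>.\<close>

lemma final_node_if_stationary:
  fixes P :: "real ^ 'n::finite ^ 'n"
  assumes P: "\<And>i. stochastic (P $ i)" and m: "\<And>i. 0 \<le> m $ i" "m v* P = m" and i: "0 < m $ i"
  shows "i \<in> final_nodes P"
  unfolding mem_final_nodes_iff
proof (intro allI impI)
  let ?E = "matrix_graph P"
  fix j assume ij: "(i, j) \<in> ?E\<^sup>*"
  have mk: "(\<Sum>k\<in>UNIV. m $ k * P $ k $ l) = m $ l" for l
    using m(2) by (auto simp: vector_matrix_mult_def vec_eq_iff)
  have pos: "0 < m $ l" if "0 < m $ k" "(k, l) \<in> ?E" for k l
  proof -
    have "0 < m $ k * P $ k $ l"
      using that P[of k] by (simp add: matrix_graph_def stochastic_def less_le)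
    also have "\<dots> \<le> (\<Sum>k\<in>UNIV. m $ k * P $ k $ l)"
      using P m(1) by (intro member_le_sum) (auto simp: stochastic_def)
    finally show ?thesis by (simp add: mk)
  qed
  define A where "A = ?E\<^sup>* `` {j}"
  have row: "(\<Sum>l\<in>A. P $ k $ l) = 1" if "k \<in> A" for k
  proof -
    have "(\<Sum>l\<in>A. P $ k $ l) = (\<Sum>l\<in>UNIV. P $ k $ l)"
      using that by (intro sum.mono_neutral_left) (auto simp: A_def matrix_graph_def intro: rtrancl_into_rtrancl)
    then show ?thesis using P[of k] by (simp add: stochastic_def)
  qed
  have "(\<Sum>l\<in>A. m $ l) = (\<Sum>k\<in>UNIV. m $ k * (\<Sum>l\<in>A. P $ k $ l))"
    unfolding sum_distrib_left by (subst sum.swap) (simp add: mk)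
  also have "\<dots> = (\<Sum>k\<in>A. m $ k * (\<Sum>l\<in>A. P $ k $ l)) + (\<Sum>k\<in>-A. m $ k * (\<Sum>l\<in>A. P $ k $ l))"
    by (subst sum.union_disjoint[symmetric]) auto
  finally have "(\<Sum>k\<in>-A. m $ k * (\<Sum>l\<in>A. P $ k $ l)) = 0"
    by (simp add: row)
  moreover have nnA: "0 \<le> (\<Sum>l\<in>A. P $ k $ l)" for k
    using P[of k] by (intro sum_nonneg) (auto simp: stochastic_def)
  ultimately have zero: "m $ k * (\<Sum>l\<in>A. P $ k $ l) = 0" if "k \<notin> A" for k
    using that m(1) by (subst (asm) sum_nonneg_eq_0_iff) auto
  \<comment> \<open>Walking back from \<open>j\<close> along the path, positivity of \<open>m\<close> forbids entering \<open>A\<close> from outside.\<close>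
  have enter: "k \<in> A" if "0 < m $ k" "(k, l) \<in> ?E" "l \<in> A" for k l
  proof (rule ccontr)
    assume "k \<notin> A"
    with zero that(1) have "(\<Sum>l\<in>A. P $ k $ l) = 0" by fastforce
    then have "P $ k $ l = 0"
      using P[of k] that(3) by (subst (asm) sum_nonneg_eq_0_iff) (auto simp: stochastic_def)
    with that(2) show False by (simp add: matrix_graph_def)
  qed
  have "0 < m $ i \<longrightarrow> i \<in> A"
    using ij
  proof (induction rule: converse_rtrancl_induct)
    case base
    show ?case by (simp add: A_def)
  next
    case (step y z)
    then show ?case using pos enter by blast
  qed
  with i show "(j, i) \<in> ?E\<^sup>*" by (auto simp: A_def)
qed

text \<open>\<open>P - mat 1\<close> kills the constant vector, so its transpose is singular too.
  This yields a signed left fixed vector, whose absolute values turn out to be fixed as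
  well.\<close>

lemma stationary_vector_exists:
  fixes P :: "real ^ 'n::finite ^ 'n"
  assumes P: "\<And>i. stochastic (P $ i)"
  obtains m where "\<And>i. 0 \<le> m $ i" "m v* P = m" "m \<noteq> 0"
proof -
  define A where "A = P - mat 1"
  have "P *v vec 1 = vec 1"
    using P by (auto simp: vec_eq_iff matrix_vector_mult_def stochastic_def)
  then have "A *v vec 1 = 0"
    by (simp add: A_def matrix_vector_mult_diff_rdistrib)
  moreover have "vec 1 \<noteq> (0 :: real ^ 'n)" by (simp add: vec_eq_iff)
  ultimately have "\<not> (\<exists>B. B ** A = mat 1)"
    by (auto simp: matrix_left_invertible_ker)
  then have "\<not> (\<exists>B. B ** transpose A = mat 1)"
    by (simp add: left_invertible_transpose matrix_left_right_inverse)
  then obtain n where n: "transpose A *v n = 0" "n \<noteq> 0"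
    by (auto simp: matrix_left_invertible_ker)
  have eq: "n $ j = (\<Sum>i\<in>UNIV. n $ i * P $ i $ j)" for j
  proof -
    have "0 = (\<Sum>i\<in>UNIV. n $ i * A $ i $ j)"
      using n(1) by (simp add: vec_eq_iff matrix_vector_mult_def transpose_def mult.commute)
    then show ?thesis
      by (simp add: A_def mat_def algebra_simps sum_subtractf)
         (simp add: sum.delta' if_distrib[of "\<lambda>x. _ * x"] cong: if_cong)
  qed
  \<comment> \<open>\<open>\<bar>n\<bar>\<close> is dominated by its image, and both have the same total mass.\<close>
  define m where "m = (\<chi> i. \<bar>n $ i\<bar>)"
  have le: "m $ j \<le> (m v* P) $ j" for j
  proof -
    have "\<bar>n $ j\<bar> = \<bar>\<Sum>i\<in>UNIV. n $ i * P $ i $ j\<bar>" by (simp only: eq[symmetric])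
    also have "\<dots> \<le> (\<Sum>i\<in>UNIV. \<bar>n $ i * P $ i $ j\<bar>)" by (rule sum_abs)
    also have "\<dots> = (\<Sum>i\<in>UNIV. \<bar>n $ i\<bar> * P $ i $ j)"
      using P by (simp add: abs_mult stochastic_def)
    finally show ?thesis by (simp add: m_def vector_matrix_mult_def)
  qed
  have "(\<Sum>j\<in>UNIV. (m v* P) $ j) = (\<Sum>i\<in>UNIV. m $ i * (\<Sum>j\<in>UNIV. P $ i $ j))"
    unfolding sum_distrib_left vector_matrix_mult_def by (simp, subst sum.swap, simp)
  then have "(\<Sum>j\<in>UNIV. (m v* P) $ j - m $ j) = 0"
    using P by (simp add: stochastic_def sum_subtractf)
  then have "\<forall>j. (m v* P) $ j - m $ j = 0"
    using le by (subst (asm) sum_nonneg_eq_0_iff) auto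
  then have "m v* P = m" by (simp add: vec_eq_iff)
  moreover have "m \<noteq> 0" using n(2) by (auto simp: m_def vec_eq_iff)
  moreover have "0 \<le> m $ i" for i by (simp add: m_def)
  ultimately show ?thesis using that by blast
qed

lemma stationary_if_final_node:
  fixes P :: "real ^ 'n::finite ^ 'n"
  assumes P: "\<And>i. stochastic (P $ i)" and i: "i \<in> final_nodes P"
  obtains m where "\<And>j. 0 \<le> m $ j" "m v* P = m" "0 < m $ i"
proof -
  let ?E = "matrix_graph P"
  define F where "F = ?E\<^sup>* `` {i}"
  \<comment> \<open>Redirecting the rows outside the final class \<open>F\<close> of \<open>i\<close> forces the stationary vector onto \<open>F\<close>.\<close>
  define Q where "Q = (\<chi> k. if k \<in> F then P $ k else axis i 1)"
  have iF: "i \<in> F" by (simp add: F_def)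
  have succF: "l \<in> F" if "k \<in> F" "P $ k $ l \<noteq> 0" for k l
    using that by (auto simp: F_def matrix_graph_def intro: rtrancl_into_rtrancl)
  have Qcol: "Q $ k $ l = 0" if "l \<notin> F" for k l
    using that succF iF by (auto simp: Q_def axis_def)
  have "stochastic (axis i 1)" by (auto simp: stochastic_def axis_def)
  then have "stochastic (Q $ k)" for k by (simp add: Q_def P)
  then obtain m where m: "\<And>i. 0 \<le> m $ i" "m v* Q = m" "m \<noteq> 0"
    using stationary_vector_exists[of Q] by blast
  have mF: "m $ l = 0" if "l \<notin> F" for l
  proof -
    have "m $ l = (m v* Q) $ l" by (simp add: m(2))
    then show ?thesis using Qcol[OF that] by (simp add: vector_matrix_mult_def)
  qed
  have mP: "m v* P = m"
  proof -
    have "m v* P = m v* Q"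
      unfolding vector_matrix_mult_def vec_eq_iff
      by (auto simp: Q_def mF intro!: sum.cong)
    then show ?thesis by (simp add: m(2))
  qed
  obtain k where k: "m $ k \<noteq> 0" using m(3) by (auto simp: vec_eq_iff)
  then have "0 < m $ k" "k \<in> F" using m(1) mF by (auto simp: less_le)
  have pos: "0 < m $ l" if "0 < m $ k" "(k, l) \<in> ?E" for k l
  proof -
    have "0 < m $ k * P $ k $ l"
      using that P[of k] by (simp add: matrix_graph_def stochastic_def less_le)
    also have "\<dots> \<le> (\<Sum>k\<in>UNIV. m $ k * P $ k $ l)"
      using P m(1) by (intro member_le_sum) (auto simp: stochastic_def)
    also have "\<dots> = (m v* P) $ l" by (simp add: vector_matrix_mult_def)
    finally show ?thesis by (simp add: mP)
  qed
  \<comment> \<open>\<open>F\<close> is strongly connected because \<open>i\<close> is final, so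
    positivity at one node of \<open>F\<close> spreads to \<open>i\<close>.\<close>
  have "(k, i) \<in> ?E\<^sup>*" using i \<open>k \<in> F\<close> by (auto simp: mem_final_nodes_iff F_def)
  then have "0 < m $ i"
    using \<open>0 < m $ k\<close> by (induction rule: rtrancl_induct) (auto intro: pos)
  then show ?thesis using that m(1) mP by blast
qed

section \<open>Fixed points and the critical graph\<close>

locale convex_mh =
  fixes f :: "real ^ 'n::finite \<Rightarrow> real ^ 'n"
  assumes convex: "convex_map f" and mono: "mono f" and homogeneous: "homogeneous f"
begin

lemma convex_comp: "convex_on UNIV (\<lambda>x. f x $ i)"
  using convex by (simp add: convex_map_def)

text \<open>Nonexpansiveness in one-sided form, with \<open>M\<close> of any sign.\<close>

lemma shift_le:
  assumes "\<And>j. a $ j \<le> M + b $ j"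
  shows "f a $ i \<le> M + f b $ i"
proof -
  have "a \<le> vec M + b" using assms by (simp add: less_eq_vec_def)
  then have "f a \<le> f (vec M + b)" using mono by (simp add: monoD)
  then show ?thesis using homogeneous by (simp add: homogeneous_def less_eq_vec_def)
qed

lemma iterate_shift_le:
  assumes "\<And>j. a $ j \<le> M + b $ j"
  shows "(f ^^ k) a $ i \<le> M + (f ^^ k) b $ i"
  by (induction k arbitrary: i) (auto intro: assms shift_le)

lemma continuous: "continuous_on UNIV f"
proof -
  have "continuous_on UNIV (\<lambda>x. f x $ i)" for i
    using convex_on_continuous[OF open_UNIV convex_comp] .
  then have "continuous_on UNIV (\<lambda>x. \<chi> i. f x $ i)"
    by (rule continuous_on_vec_lambda)
  then show ?thesis by simp
qed

lemma continuous_iterate: "continuous_on UNIV (f ^^ k)"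
proof (induction k)
  case (Suc k)
  then show ?case
    using continuous_on_compose[OF Suc continuous_on_subset[OF continuous]] by (simp add: comp_def)
qed (simp add: continuous_on_id')

lemma tendsto_map:
  assumes "(g \<longlongrightarrow> l) F"
  shows "((\<lambda>x. f (g x)) \<longlongrightarrow> f l) F"
  using continuous assms by (metis UNIV_I continuous_on_eq_continuous_at isCont_tendsto_compose open_UNIV)

text \<open>Direction \<open>axis j (-1)\<close> with monotonicity gives the signs; the constants 1
  and -1 with homogeneity bound the row sum from both sides.\<close>

lemma subgradient_stochastic:
  assumes "subgradient (\<lambda>x. f x $ i) x q"
  shows "stochastic q"
proof -
  have q: "q \<bullet> z \<le> f (x + z) $ i - f x $ i" for z
    using assms[unfolded subgradient_def, rule_format, of "x + z"] by simp
  have "0 \<le> q $ j" for j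
  proof -
    have "f (x + axis j (-1)) \<le> f x"
      using mono by (intro monoD[of f]) (auto simp: less_eq_vec_def axis_def)
    then show ?thesis
      using q[of "axis j (-1)"] by (simp add: inner_axis less_eq_vec_def) (smt (verit))
  qed
  moreover have "q \<bullet> vec c \<le> c" for c
  proof -
    have "f (x + vec c) = vec c + f x"
      using homogeneous by (simp add: homogeneous_def add.commute)
    then show ?thesis using q[of "vec c"] by simp
  qed
  from this[of 1] this[of "-1"] have "(\<Sum>j\<in>UNIV. q $ j) = 1"
    by (simp add: inner_vec_def sum_negf)
  ultimately show ?thesis by (simp add: stochastic_def)
qed

text \<open>The subgradient is taken at the midpoint of \<open>a\<close> and \<open>b\<close>: by convexity and nonexpansiveness,
  \<open>f\<^sub>i\<close> increases by exactly \<open>M / 2\<close> on each half of the segment.\<close>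

lemma subgradient_supported_on_argmax:
  assumes le: "\<And>j. a $ j \<le> M + b $ j" and i: "f a $ i = M + f b $ i"
  obtains q where "subgradient (\<lambda>x. f x $ i) b q"
    and "\<And>j. q $ j \<noteq> 0 \<Longrightarrow> a $ j = M + b $ j"
proof -
  define h where "h = (1 / 2) *\<^sub>R a + (1 / 2) *\<^sub>R b"
  obtain q where q: "subgradient (\<lambda>x. f x $ i) h q"
    using subgradient_exists[OF convex_comp] by blast
  have st: "stochastic q" by (rule subgradient_stochastic[OF q])
  have "f h $ i \<le> (1 / 2) * (f a $ i) + (1 / 2) * (f b $ i)"
    using convex_onD[OF convex_comp[of i], of "1 / 2" a b] by (simp add: h_def)
  moreover have "f a $ i \<le> M / 2 + f h $ i"
  proof (rule shift_le)
    show "a $ j \<le> M / 2 + h $ j" for j using le[of j] by (simp add: h_def field_simps)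
  qed
  ultimately have hi: "f h $ i = M / 2 + f b $ i" using i by linarith
  have "h - b = (1 / 2) *\<^sub>R (a - b)" "b - h = - (1 / 2) *\<^sub>R (a - b)"
    by (simp_all add: h_def algebra_simps flip: scaleR_left_distrib)
  then have eq: "q \<bullet> (h - b) = q \<bullet> (a - b) / 2" "q \<bullet> (b - h) = - (q \<bullet> (a - b)) / 2" by simp_all
  \<comment> \<open>With the upper bound below, the \<open>q\<close>-average of \<open>a - b\<close>
    equals its maximum \<open>M\<close>; so \<open>q\<close> charges only the argmax, and its
    minorant also touches at \<open>b\<close>.\<close>
  have lb: "M \<le> q \<bullet> (a - b)"
    using q[unfolded subgradient_def, rule_format, of b] hi eq by simp
  have "q \<bullet> (a - b) \<le> M" using st le by (intro stochastic_inner_le) (auto simp: algebra_simps)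
  then have "subgradient (\<lambda>x. f x $ i) b q"
    using q hi eq by (intro subgradient_transfer[OF q]) simp
  moreover have "a $ j = M + b $ j" if "q $ j \<noteq> 0" for j
    using stochastic_inner_eq_max[OF st _ lb that] le by (simp add: algebra_simps)
  ultimately show ?thesis using that by blast
qed

end

locale convex_mh_fixed = convex_mh f for f :: "real ^ 'n::finite \<Rightarrow> real ^ 'n" +
  fixes v :: "real ^ 'n"
  assumes fixed: "f v = v"
begin

lemma subdifferential_stochastic: "P \<in> subdifferential f v \<Longrightarrow> stochastic (P $ i)"
  using subgradient_stochastic by (auto simp: mem_subdifferential_iff)

text \<open>The subdifferential is a product over rows, so the given subgradients fit into a single
  matrix, with arbitrary rows outside \<open>A\<close>, and \<open>A\<close> is closed in its
  graph.\<close>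

lemma closed_set_meets_critical_nodes:
  assumes "A \<noteq> {}" and "\<And>i. i \<in> A \<Longrightarrow>
    \<exists>q. subgradient (\<lambda>x. f x $ i) v q \<and> (\<forall>j. q $ j \<noteq> 0 \<longrightarrow> j \<in> A)"
  shows "A \<inter> critical_nodes f v \<noteq> {}"
proof -
  have "\<forall>i. \<exists>q. subgradient (\<lambda>x. f x $ i) v q \<and> (i \<in> A \<longrightarrow> (\<forall>j. q $ j \<noteq> 0 \<longrightarrow> j \<in> A))"
    using assms(2) subgradient_exists[OF convex_comp] by metis
  then obtain Q where Q: "\<And>i. subgradient (\<lambda>x. f x $ i) v (Q i)"
    "\<And>i j. i \<in> A \<Longrightarrow> Q i $ j \<noteq> 0 \<Longrightarrow> j \<in> A"
    by metis
  define P where "P = (\<chi> i. Q i)"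
  have "P \<in> subdifferential f v" by (simp add: mem_subdifferential_iff P_def Q)
  moreover have "A \<inter> final_nodes P \<noteq> {}"
    by (rule closed_set_meets_final_nodes) (auto simp: P_def assms(1) intro: Q(2))
  ultimately show ?thesis by (auto simp: critical_nodes_def)
qed

text \<open>Two orbits, \<open>\<alpha>\<close> and \<open>\<beta>\<close>, are compared along a compact set on which one can step backwards.
  Among the pairs where \<open>\<alpha> - \<beta>\<close> is maximal, those where \<open>\<beta> - v\<close> is maximal project onto a set of
  coordinates that is closed under subgradients at \<open>v\<close>.\<close>

lemma maximal_gap_on_critical_nodes:
  fixes \<alpha> \<beta> :: "real ^ 'n \<Rightarrow> real ^ 'n"
  assumes K: "compact K" "K \<noteq> {}" "K \<subseteq> f ` K"
    and cont: "continuous_on K \<alpha>" "continuous_on K \<beta>"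
    and comm: "\<And>y. y \<in> K \<Longrightarrow> \<alpha> (f y) = f (\<alpha> y)" "\<And>y. y \<in> K \<Longrightarrow> \<beta> (f y) = f (\<beta> y)"
  obtains y i where "y \<in> K" "i \<in> critical_nodes f v"
    and "\<And>z j. z \<in> K \<Longrightarrow> \<alpha> z $ j - \<beta> z $ j \<le> \<alpha> y $ i - \<beta> y $ i"
proof -
  have contc: "continuous_on K (\<lambda>y. \<alpha> y $ i)" "continuous_on K (\<lambda>y. \<beta> y $ i)" for i
    using cont by (auto intro!: continuous_intros)
  define G where "G = (\<Union>i. (\<lambda>y. \<alpha> y $ i - \<beta> y $ i) ` K)"
  have "compact G" unfolding G_def
    using K(1) cont by (intro compact_UN compact_continuous_image continuous_intros) auto
  moreover have "G \<noteq> {}" using K(2) by (auto simp: G_def)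
  ultimately obtain M where "M \<in> G" and GM: "\<And>t. t \<in> G \<Longrightarrow> t \<le> M"
    using compact_attains_sup by metis
  then obtain y0 i0 where y0: "y0 \<in> K" "\<alpha> y0 $ i0 - \<beta> y0 $ i0 = M"
    by (auto simp: G_def)
  have M: "\<alpha> z $ j - \<beta> z $ j \<le> M" if "z \<in> K" for z j
    using that by (intro GM) (auto simp: G_def)
  define Z where "Z i = {y \<in> K. \<alpha> y $ i - \<beta> y $ i = M}" for i
  have "closed (Z i)" for i
    using continuous_closed_preimage_constant[of K "\<lambda>y. \<alpha> y $ i - \<beta> y $ i" M] K(1)
      continuous_on_diff[OF contc[of i]]
    by (simp add: Z_def compact_imp_closed)
  then have cZ: "compact (Z i)" for i
    using compact_Int_closed[OF K(1), of "Z i"] by (simp add: Z_def Int_absorb1 Collect_restrict)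
  define H where "H = (\<Union>i. (\<lambda>y. \<beta> y $ i - v $ i) ` Z i)"
  have "compact H" unfolding H_def
    using cZ continuous_on_subset[OF cont(2)]
    by (intro compact_UN compact_continuous_image continuous_intros) (auto simp: Z_def)
  moreover have "H \<noteq> {}" using y0 by (auto simp: H_def Z_def)
  ultimately obtain s where sH: "s \<in> H" and Hs: "\<And>t. t \<in> H \<Longrightarrow> t \<le> s"
    using compact_attains_sup by metis
  have s: "\<beta> y $ i - v $ i \<le> s" if "y \<in> Z i" for y i
    using that by (intro Hs) (auto simp: H_def)
  define A where "A = {i. \<exists>y\<in>Z i. \<beta> y $ i - v $ i = s}"
  have "A \<inter> critical_nodes f v \<noteq> {}"
  proof (rule closed_set_meets_critical_nodes)
    show "A \<noteq> {}" using sH by (auto simp: H_def A_def)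
    fix i assume "i \<in> A"
    then obtain y where y: "y \<in> K" "\<alpha> y $ i - \<beta> y $ i = M" "\<beta> y $ i - v $ i = s"
      by (auto simp: A_def Z_def)
    \<comment> \<open>A subgradient of coordinate \<open>i\<close> relates values at
      \<open>f x\<close> to averages of values at \<open>x\<close>, so extremality is passed on to a
      preimage, which must lie in \<open>K\<close>.\<close>
    obtain x where x: "x \<in> K" "y = f x" using y(1) K(3) by auto
    have "\<alpha> x $ j \<le> M + \<beta> x $ j" for j using M[OF x(1), of j] by simp
    moreover have "f (\<alpha> x) $ i = M + f (\<beta> x) $ i" using y(2) x comm by simp
    ultimately obtain q where q: "subgradient (\<lambda>x. f x $ i) (\<beta> x) q"
      and supp: "\<And>j. q $ j \<noteq> 0 \<Longrightarrow> \<alpha> x $ j = M + \<beta> x $ j"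
      by (rule subgradient_supported_on_argmax) blast
    have st: "stochastic q" by (rule subgradient_stochastic[OF q])
    have qZ: "x \<in> Z j" if "q $ j \<noteq> 0" for j using supp[OF that] x by (simp add: Z_def)
    have fs: "f (\<beta> x) $ i - f v $ i = s" using y(3) x comm fixed by simp
    \<comment> \<open>Second maximisation at work: the subgradient inequality towards
      \<open>v\<close> bounds \<open>s\<close> by an average of values at most \<open>s\<close>. All
      of them equal \<open>s\<close>, which makes that inequality tight and lets \<open>q\<close>
      move to \<open>v\<close>.\<close>
    then have lb: "s \<le> q \<bullet> (\<beta> x - v)"
      using q[unfolded subgradient_def, rule_format, of v] by (simp add: inner_diff_right)
    have "j \<in> A \<and> (\<beta> x - v) $ j = s" if "q $ j \<noteq> 0" for j
    proof -
      have "(\<beta> x - v) $ j = s"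
        using stochastic_inner_eq_max[OF st _ lb that] s qZ by simp
      then show ?thesis using qZ[OF that] by (auto simp: A_def)
    qed
    moreover from this have "q \<bullet> (\<beta> x - v) = s" using stochastic_inner_const[OF st] by blast
    then have "subgradient (\<lambda>x. f x $ i) v q"
      using fs by (intro subgradient_transfer[OF q]) simp
    ultimately show "\<exists>q. subgradient (\<lambda>x. f x $ i) v q \<and> (\<forall>j. q $ j \<noteq> 0 \<longrightarrow> j \<in> A)" by blast
  qed
  then obtain i where i: "i \<in> A" "i \<in> critical_nodes f v" by blast
  then obtain y where "y \<in> Z i" by (auto simp: A_def)
  then show ?thesis using that[of y i] i M by (simp add: Z_def)
qed

lemma fixed_points_le_if_le_on_critical_nodes:
  assumes "f a = a" "f b = b" and le: "\<And>i. i \<in> critical_nodes f v \<Longrightarrow> a $ i \<le> b $ i"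
  shows "a \<le> b"
proof -
  \<comment> \<open>Constant maps on the one-point set \<open>{v}\<close>: a fixed point is its own
    backward orbit.\<close>
  have "\<exists>i\<in>critical_nodes f v. \<forall>j. a $ j - b $ j \<le> a $ i - b $ i"
    by (rule maximal_gap_on_critical_nodes[of "{v}" "\<lambda>_. a" "\<lambda>_. b"])
       (auto simp: assms(1,2) fixed | blast)+
  then show ?thesis using le by (auto simp: less_eq_vec_def) (smt (verit))
qed

lemma subgradient_row: "P \<in> subdifferential f v \<Longrightarrow> (P $ i) \<bullet> (x - v) \<le> f x $ i - v $ i"
  using fixed by (auto simp: mem_subdifferential_iff subgradient_def)

text \<open>Minimum principle for \<open>w - v\<close> on a final class: at a minimising node the
  row average is at most the minimum, so the minimum spreads along all arcs. Constancy then turns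
  the subgradient inequality into \<open>w $ i \<le> f w $ i\<close>.\<close>

lemma superharmonic_on_final_nodes:
  assumes w: "f w \<le> w" and P: "P \<in> subdifferential f v" and i: "i \<in> final_nodes P"
  shows "f w $ i = w $ i" and "P $ i $ j \<noteq> 0 \<Longrightarrow> w $ i - v $ i = w $ j - v $ j"
proof -
  let ?E = "matrix_graph P"
  define F where "F = ?E\<^sup>* `` {i}"
  obtain k where k: "k \<in> F" and kmin: "\<And>j. j \<in> F \<Longrightarrow> (w - v) $ k \<le> (w - v) $ j"
  proof -
    have "Min ((\<lambda>j. (w - v) $ j) ` F) \<in> (\<lambda>j. (w - v) $ j) ` F"
      by (rule Min_in) (auto simp: F_def)
    then obtain k where "k \<in> F" "Min ((\<lambda>j. (w - v) $ j) ` F) = (w - v) $ k" by auto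
    then show ?thesis using that[of k] by (metis Min_le finite finite_imageI imageI)
  qed
  have Pw: "(P $ l) \<bullet> (w - v) \<le> w $ l - v $ l" for l
    using subgradient_row[OF P, of l w] w by (auto simp: less_eq_vec_def intro: order_trans)
  have "(w - v) $ l = (w - v) $ k" if "(k, l) \<in> ?E\<^sup>*" for l
    using that
  proof (induction rule: rtrancl_induct)
    case (step l m)
    have st: "stochastic (P $ l)" by (rule subdifferential_stochastic[OF P])
    have lF: "(i, l) \<in> ?E\<^sup>*" using k step(1) by (auto simp: F_def)
    \<comment> \<open>Signs are reversed to reuse the equality case for maxima.\<close>
    have "(v - w) $ m = (v - w) $ l"
    proof (rule stochastic_inner_eq_max[OF st])
      show "(v - w) $ j \<le> (v - w) $ l" if "P $ l $ j \<noteq> 0" for j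
      proof -
        have "(l, j) \<in> ?E" using that by (simp add: matrix_graph_def)
        with lF have "j \<in> F" by (auto simp: F_def)
        then show ?thesis using kmin[of j] step(3) by simp
      qed
      show "(v - w) $ l \<le> (P $ l) \<bullet> (v - w)"
        using Pw[of l] by (simp add: inner_diff_right)
      show "P $ l $ m \<noteq> 0" using step(2) by (simp add: matrix_graph_def)
    qed
    then show ?case using step(3) by simp
  qed simp
  moreover have "(k, l) \<in> ?E\<^sup>*" if "l \<in> F" for l
    using i k that by (auto simp: mem_final_nodes_iff F_def intro: rtrancl_trans)
  ultimately have const: "(w - v) $ l = (w - v) $ i" if "l \<in> F" for l
    using that by (metis F_def Image_singleton_iff rtrancl.rtrancl_refl)
  have succ: "j \<in> F" if "P $ i $ j \<noteq> 0" for j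
    using that by (auto simp: F_def matrix_graph_def)
  then show "P $ i $ j \<noteq> 0 \<Longrightarrow> w $ i - v $ i = w $ j - v $ j"
    using const[of j] by simp
  have "(P $ i) \<bullet> (w - v) = (w - v) $ i"
    using succ const by (intro stochastic_inner_const[OF subdifferential_stochastic[OF P]]) auto
  then have "w $ i \<le> f w $ i" using subgradient_row[OF P, of i w] by simp
  then show "f w $ i = w $ i" using w by (simp add: less_eq_vec_def eq_iff)
qed

lemma superharmonic_eq_on_critical_nodes:
  "f w \<le> w \<Longrightarrow> i \<in> critical_nodes f v \<Longrightarrow> f w $ i = w $ i"
  using superharmonic_on_final_nodes(1) by (auto simp: critical_nodes_def)

lemma superharmonic_const_on_critical_arcs:
  "f w \<le> w \<Longrightarrow> (i, j) \<in> critical_arcs f v \<Longrightarrow> w $ i - v $ i = w $ j - v $ j"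
  using superharmonic_on_final_nodes(2) by (auto simp: critical_arcs_def mem_final_arcs_iff)

lemma superharmonic_fixed_point:
  assumes w: "f w \<le> w"
  obtains z where "f z = z" "\<And>i. i \<in> critical_nodes f v \<Longrightarrow> z $ i = w $ i"
proof -
  have dec: "f ((f ^^ k) w) \<le> (f ^^ k) w" for k
    by (induction k) (use w monoD[OF mono] in auto)
  obtain B where B: "\<And>j. v $ j \<le> B + w $ j"
  proof
    show "v $ j \<le> norm (v - w) + w $ j" for j
      using component_le_norm_cart[of "v - w" j] by simp
  qed
  have fv: "(f ^^ k) v = v" for k by (induction k) (simp_all add: fixed)
  have lb: "v $ j - B \<le> (f ^^ k) w $ j" for k j
    using iterate_shift_le[of v B w k j] B fv by (simp add: algebra_simps)
  have "decseq (\<lambda>k. (f ^^ k) w $ j)" for j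
    using dec by (intro decseq_SucI) (simp add: less_eq_vec_def)
  then have "\<exists>l. (\<lambda>k. (f ^^ k) w $ j) \<longlonglongrightarrow> l" for j
    using decseq_convergent[of "\<lambda>k. (f ^^ k) w $ j" "v $ j - B"] lb by metis
  then obtain l where l: "\<And>j. (\<lambda>k. (f ^^ k) w $ j) \<longlonglongrightarrow> l j" by metis
  define z where "z = (\<chi> j. l j)"
  have lim: "(\<lambda>k. (f ^^ k) w) \<longlonglongrightarrow> z"
    using l by (intro vec_tendstoI) (simp add: z_def)
  have "(\<lambda>k. (f ^^ Suc k) w) \<longlonglongrightarrow> f z"
    using tendsto_map[OF lim] by simp
  moreover have "(\<lambda>k. (f ^^ Suc k) w) \<longlonglongrightarrow> z"
    using LIMSEQ_Suc[OF lim] .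
  ultimately have "f z = z" by (rule LIMSEQ_unique)
  moreover have "z $ i = w $ i" if i: "i \<in> critical_nodes f v" for i
  proof -
    have "(f ^^ k) w $ i = w $ i" for k
      by (induction k) (use superharmonic_eq_on_critical_nodes[OF dec i] in auto)
    then have "(\<lambda>k. w $ i) \<longlonglongrightarrow> z $ i"
      using tendsto_vec_nth[OF lim, of i] by simp
    then show ?thesis by (simp add: LIMSEQ_const_iff)
  qed
  ultimately show ?thesis using that by blast
qed

lemma restriction_fixed_points:
  "restriction (critical_nodes f v) ` {x. f x = x} = restriction (critical_nodes f v) ` {x. f x \<le> x}"
proof (intro equalityI subsetI)
  fix y assume "y \<in> restriction (critical_nodes f v) ` {x. f x \<le> x}"
  then obtain w where w: "f w \<le> w" "y = restriction (critical_nodes f v) w" by auto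
  obtain z where "f z = z" "\<And>i. i \<in> critical_nodes f v \<Longrightarrow> z $ i = w $ i"
    using superharmonic_fixed_point[OF w(1)] by blast
  moreover from this have "y = restriction (critical_nodes f v) z"
    using w(2) by (simp add: restriction_def vec_eq_iff)
  ultimately show "y \<in> restriction (critical_nodes f v) ` {x. f x = x}" by blast
qed auto

end

section \<open>Dimension\<close>

lemma equiv_graph_classes:
  "equiv N {(i, j) \<in> N \<times> N. (i, j) \<in> E\<^sup>* \<and> (j, i) \<in> E\<^sup>*}"
  by (rule equivI) (auto simp: refl_on_def sym_def trans_def intro: rtrancl_trans)

lemma Union_graph_classes: "\<Union>(graph_classes N E) = N"
  unfolding graph_classes_def by (rule Union_quotient[OF equiv_graph_classes])

lemma graph_classes_disjoint:
  "K \<in> graph_classes N E \<Longrightarrow> L \<in> graph_classes N E \<Longrightarrow> i \<in> K \<Longrightarrow> i \<in> L \<Longrightarrow> K = L"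
  unfolding graph_classes_def using quotient_disj[OF equiv_graph_classes] by blast

lemma graph_classes_nonempty: "K \<in> graph_classes N E \<Longrightarrow> K \<noteq> {}"
  unfolding graph_classes_def by (rule in_quotient_imp_non_empty[OF equiv_graph_classes])

lemma graph_classes_connected:
  "K \<in> graph_classes N E \<Longrightarrow> i \<in> K \<Longrightarrow> j \<in> K \<Longrightarrow> (i, j) \<in> E\<^sup>*"
  unfolding graph_classes_def using in_quotient_imp_in_rel[OF equiv_graph_classes, of K N E i j] by auto

lemma graph_classes_closed:
  "K \<in> graph_classes N E \<Longrightarrow> i \<in> K \<Longrightarrow> j \<in> N \<Longrightarrow> (i, j) \<in> E\<^sup>* \<Longrightarrow> (j, i) \<in> E\<^sup>* \<Longrightarrow> j \<in> K"
  unfolding graph_classes_def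
  using in_quotient_imp_closed[OF equiv_graph_classes, of K N E i j]
    in_quotient_imp_subset[OF equiv_graph_classes, of K N E] by auto

lemma finite_graph_classes: "finite N \<Longrightarrow> finite (graph_classes N E)"
  unfolding graph_classes_def by (rule finite_quotient) auto

lemma restriction_eq_sum_graph_classes:
  fixes u :: "real ^ 'n::finite"
  assumes "\<And>K i j. K \<in> graph_classes N E \<Longrightarrow> i \<in> K \<Longrightarrow> j \<in> K \<Longrightarrow> u $ i = u $ j"
  shows "restriction N u = (\<Sum>K\<in>graph_classes N E. u $ (SOME i. i \<in> K) *\<^sub>R restriction K (vec 1))"
proof -
  have "(\<Sum>K\<in>graph_classes N E. u $ (SOME i. i \<in> K) * (if i \<in> K then 1 else 0)) = (if i \<in> N then u $ i else 0)" for i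
  proof (cases "i \<in> N")
    case True
    then obtain L where L: "L \<in> graph_classes N E" "i \<in> L"
      using Union_graph_classes[of N E] by blast
    have "(\<Sum>K\<in>graph_classes N E. u $ (SOME i. i \<in> K) * (if i \<in> K then 1 else 0)) =
        (\<Sum>K\<in>{L}. u $ (SOME i. i \<in> K) * (if i \<in> K then 1 else 0))"
    proof (rule sum.mono_neutral_right)
      show "\<forall>K\<in>graph_classes N E - {L}. u $ (SOME i. i \<in> K) * (if i \<in> K then 1 else 0) = 0"
      proof
        fix K assume K: "K \<in> graph_classes N E - {L}"
        then have "i \<notin> K" using graph_classes_disjoint[of K N E L i] L by blast
        then show "u $ (SOME i. i \<in> K) * (if i \<in> K then 1 else 0) = 0" by simp
      qed
    qed (use L in \<open>auto simp: finite_graph_classes\<close>)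
    moreover have "u $ (SOME i. i \<in> L) = u $ i"
      by (rule assms[OF L(1) someI[of "\<lambda>i. i \<in> L", OF L(2)] L(2)])
    ultimately show ?thesis using L True by simp
  next
    case False
    then have "i \<notin> K" if "K \<in> graph_classes N E" for K
      using that Union_graph_classes[of N E] by blast
    then show ?thesis using False by simp
  qed
  then show ?thesis by (simp add: vec_eq_iff restriction_def cong: if_cong)
qed

text \<open>Disjoint supports make the indicators orthogonal. The factor \<open>\<eta>\<close>
  serves the small perturbations behind the lower bound on the dimension.\<close>

lemma indicator_graph_classes:
  fixes N :: "'n::finite set" and E :: "'n rel"
  assumes "\<eta> \<noteq> (0 :: real)"
  defines "B \<equiv> (\<lambda>K. \<eta> *\<^sub>R restriction K (vec 1 :: real ^ 'n)) ` graph_classes N E"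
  shows "independent B" and "card B = card (graph_classes N E)"
proof -
  have orth: "restriction K (vec 1 :: real ^ 'n) \<bullet> restriction L (vec 1) = 0"
    if "K \<in> graph_classes N E" "L \<in> graph_classes N E" "K \<noteq> L" for K L
  proof -
    have "i \<notin> K \<or> i \<notin> L" for i using graph_classes_disjoint[OF that(1,2)] that(3) by blast
    then show ?thesis by (fastforce simp: inner_vec_def restriction_def intro!: sum.neutral)
  qed
  have nz: "restriction K (vec 1 :: real ^ 'n) \<noteq> 0" if "K \<in> graph_classes N E" for K
    using graph_classes_nonempty[OF that] by (auto simp: restriction_def vec_eq_iff)
  have "pairwise orthogonal B"
    unfolding pairwise_def B_def orthogonal_def using orth by auto
  moreover have "0 \<notin> B" using nz assms(1) by (auto simp: B_def)
  ultimately show "independent B" by (rule pairwise_orthogonal_independent)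
  have "inj_on (\<lambda>K. \<eta> *\<^sub>R restriction K (vec 1 :: real ^ 'n)) (graph_classes N E)"
  proof (rule inj_onI, rule ccontr)
    fix K L assume KL: "K \<in> graph_classes N E" "L \<in> graph_classes N E" "K \<noteq> L"
      and "\<eta> *\<^sub>R restriction K (vec 1 :: real ^ 'n) = \<eta> *\<^sub>R restriction L (vec 1)"
    with assms(1) have "restriction K (vec 1 :: real ^ 'n) = restriction L (vec 1)" by simp
    with orth[OF KL] nz[OF KL(2)] show False by simp
  qed
  then show "card B = card (graph_classes N E)" by (simp add: B_def card_image)
qed

lemma card_le_aff_dim:
  fixes S :: "'a::euclidean_space set"
  assumes "independent B" "p \<in> S" "\<And>b. b \<in> B \<Longrightarrow> p + b \<in> S"
  shows "int (card B) \<le> aff_dim S"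
proof -
  have "B \<subseteq> (+) (- p) ` S"
  proof
    fix b assume "b \<in> B"
    then have "b = - p + (p + b)" "p + b \<in> S" using assms(3) by auto
    then show "b \<in> (+) (- p) ` S" by blast
  qed
  then have "card B \<le> dim ((+) (- p) ` S)"
    using assms(1) by (metis dim_eq_card_independent dim_subset)
  then show ?thesis
    using aff_dim_eq_dim[of p S] assms(2) by (simp add: hull_inc)
qed

section \<open>Farkas' lemma and convex piecewise affine maps\<close>

lemma farkas:
  fixes g :: "'k \<Rightarrow> 'a::euclidean_space"
  assumes "finite I" and le: "\<And>w. (\<And>k. k \<in> I \<Longrightarrow> g k \<bullet> w \<le> 0) \<Longrightarrow> a \<bullet> w \<le> 0"
  obtains c where "\<And>k. 0 \<le> (c k :: real)" "a = (\<Sum>k\<in>I. c k *\<^sub>R g k)"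
proof -
  define T where "T = {\<Sum>k\<in>I. c k *\<^sub>R g k | c. \<forall>k. 0 \<le> (c k :: real)}"
  have "convex_cone T"
    unfolding convex_cone_iff
  proof (intro conjI ballI allI impI)
    show "0 \<in> T" unfolding T_def by (intro CollectI exI[of _ "\<lambda>_. 0"]) simp
  next
    fix x y assume "x \<in> T" "y \<in> T"
    then obtain c d where "x = (\<Sum>k\<in>I. c k *\<^sub>R g k)" "\<forall>k. 0 \<le> c k" "y = (\<Sum>k\<in>I. d k *\<^sub>R g k)" "\<forall>k. 0 \<le> d k"
      by (auto simp: T_def)
    then show "x + y \<in> T" unfolding T_def
      by (intro CollectI exI[of _ "\<lambda>k. c k + d k"]) (simp add: scaleR_left_distrib sum.distrib)
  next
    fix x and t :: real assume "x \<in> T" "0 \<le> t"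
    moreover from this obtain c where "x = (\<Sum>k\<in>I. c k *\<^sub>R g k)" "\<forall>k. 0 \<le> c k"
      by (auto simp: T_def)
    ultimately show "t *\<^sub>R x \<in> T" unfolding T_def
      by (intro CollectI exI[of _ "\<lambda>k. t * c k"]) (simp add: scaleR_sum_right)
  qed
  moreover have "g ` I \<subseteq> T"
  proof
    fix x assume "x \<in> g ` I"
    then obtain l where l: "l \<in> I" "x = g l" by auto
    have "(\<Sum>k\<in>I. (if k = l then 1 else 0) *\<^sub>R g k) = (\<Sum>k\<in>I. if k = l then g k else 0)"
      by (intro sum.cong) auto
    also have "\<dots> = g l" using l(1) assms(1) by simp
    finally show "x \<in> T" unfolding T_def l(2)
      by (intro CollectI exI[of _ "\<lambda>k. if k = l then 1 else 0"]) auto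
  qed
  ultimately have "convex_cone hull (g ` I) \<subseteq> T" by (simp add: hull_minimal)
  \<comment> \<open>A finitely generated cone is closed, so a point outside is strictly separated
    from it. The separating bound is negative because 0 is in the cone, and scaling makes
    \<open>w\<close> nonnegative on the cone; \<open>- w\<close> then violates
    \<open>le\<close>.\<close>
  moreover have "a \<in> convex_cone hull (g ` I)"
  proof (rule ccontr)
    let ?H = "convex_cone hull (g ` I)"
    assume "a \<notin> ?H"
    moreover have "closed ?H" using assms(1) by (simp add: closed_convex_cone_hull)
    ultimately have "\<exists>w b. w \<bullet> a < b \<and> (\<forall>x\<in>?H. b < w \<bullet> x)"
      by (intro separating_hyperplane_closed_point convex_convex_cone_hull)
    then obtain w b where w: "w \<bullet> a < b" "\<And>x. x \<in> ?H \<Longrightarrow> b < w \<bullet> x" by blast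
    have "b < 0" using w(2)[OF convex_cone_hull_contains_0] by simp
    have "0 \<le> w \<bullet> x" if x: "x \<in> ?H" for x
    proof (rule ccontr)
      assume neg: "\<not> 0 \<le> w \<bullet> x"
      \<comment> \<open>The multiple of \<open>x\<close> by this factor takes the value
        \<open>b\<close> exactly, against strict separation.\<close>
      then have "0 \<le> b / (w \<bullet> x)" using \<open>b < 0\<close> by (intro divide_nonpos_neg) auto
      then have "(b / (w \<bullet> x)) *\<^sub>R x \<in> ?H" using x by (simp add: convex_cone_hull_mul)
      from w(2)[OF this] neg show False by simp
    qed
    then have "g k \<bullet> (- w) \<le> 0" if "k \<in> I" for k
      using that by (simp add: hull_inc inner_commute[of "g k"])
    then have "a \<bullet> (- w) \<le> 0" by (rule le)
    with w(1) \<open>b < 0\<close> show False by (simp add: inner_commute)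
  qed
  ultimately have "a \<in> T" by blast
  then show ?thesis using that by (auto simp: T_def)
qed

lemma interior_finite_Union_closed_empty:
  assumes "finite \<F>" "\<And>S. S \<in> \<F> \<Longrightarrow> closed S \<and> interior S = {}"
  shows "interior (\<Union>\<F>) = {}"
  using assms
proof (induction rule: finite_induct)
  case (insert S \<F>)
  then show ?case
    using interior_closed_Un_empty_interior[of S "\<Union>\<F>"] by auto
qed simp

text \<open>Only the full-dimensional pieces matter: their union is closed and dense, and the affine
  map attached to such a piece is a minorant of the convex map.\<close>

lemma convex_piecewise_affine_eq_max:
  fixes f :: "real ^ 'n::finite \<Rightarrow> real ^ 'm::finite"
  assumes "convex_map f" "piecewise_affine f"
  obtains J where "finite J" "\<And>A b y. (A, b) \<in> J \<Longrightarrow> A *v y + b \<le> f y"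
    and "\<And>y. \<exists>(A, b)\<in>J. f y = A *v y + b"
proof -
  obtain \<P> where fin: "finite \<P>" and cover: "\<Union>\<P> = UNIV" and poly: "\<And>S. S \<in> \<P> \<Longrightarrow> polyhedron S"
    and "\<forall>S\<in>\<P>. \<exists>A b. \<forall>x\<in>S. f x = A *v x + b"
    using assms(2) unfolding piecewise_affine_def by metis
  then obtain A b where Ab: "\<And>S x. S \<in> \<P> \<Longrightarrow> x \<in> S \<Longrightarrow> f x = A S *v x + b S" by metis
  define \<Q> where "\<Q> = {S \<in> \<P>. interior S \<noteq> {}}"
  have "interior (\<Union>(\<P> - \<Q>)) = {}"
    using fin poly by (intro interior_finite_Union_closed_empty) (auto simp: \<Q>_def polyhedron_imp_closed)
  moreover have "closed (\<Union>\<Q>)"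
    using fin poly by (intro closed_Union) (auto simp: \<Q>_def polyhedron_imp_closed)
  moreover have "- \<Union>\<Q> \<subseteq> \<Union>(\<P> - \<Q>)" using cover by blast
  ultimately have "- \<Union>\<Q> = {}"
    using interior_maximal[of "- \<Union>\<Q>" "\<Union>(\<P> - \<Q>)"] by (simp add: open_Compl)
  then have coverQ: "\<exists>S\<in>\<Q>. y \<in> S" for y by blast
  have minorant: "A S *v y + b S \<le> f y" if SQ: "S \<in> \<Q>" for S y
  proof -
    have S: "S \<in> \<P>" using SQ by (simp add: \<Q>_def)
    obtain x where "x \<in> interior S" using SQ by (auto simp: \<Q>_def)
    then obtain e where x: "0 < e" "ball x e \<subseteq> S" by (auto simp: mem_interior)
    obtain t where t: "0 < t" "t < 1" "t * norm (y - x) < e"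
    proof
      \<comment> \<open>Small enough to stay in the ball around \<open>x\<close>;
        \<open>1 / 2\<close> gives \<open>t < 1\<close>, and the added 1 avoids division by zero
        when \<open>y = x\<close>.\<close>
      let ?t = "min (1 / 2) (e / (2 * (norm (y - x) + 1)))"
      have n: "0 < 2 * (norm (y - x) + 1)" by (simp add: add_nonneg_pos)
      show "0 < ?t" using x(1) n by simp
      show "?t < 1" by simp
      have "?t * norm (y - x) \<le> e / (2 * (norm (y - x) + 1)) * norm (y - x)"
        by (intro mult_right_mono) auto
      also have "\<dots> < e" using x(1) n by (simp add: field_simps add_pos_nonneg)
      finally show "?t * norm (y - x) < e" .
    qed
    have mid: "(1 - t) *\<^sub>R x + t *\<^sub>R y = x + t *\<^sub>R (y - x)" by (simp add: algebra_simps)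
    have inS: "x \<in> S" "x + t *\<^sub>R (y - x) \<in> S"
      using x t by (auto simp: dist_norm)
    have "(A S *v y + b S) $ i \<le> f y $ i" for i
    proof -
      have "convex_on UNIV (\<lambda>x. f x $ i)" using assms(1) by (simp add: convex_map_def)
      then have "f ((1 - t) *\<^sub>R x + t *\<^sub>R y) $ i \<le> (1 - t) * f x $ i + t * f y $ i"
        using convex_onD[of UNIV "\<lambda>x. f x $ i" t x y] t by simp
      \<comment> \<open>Both \<open>x\<close> and the intermediate point lie in \<open>S\<close>,
        where \<open>f\<close> is affine; comparing with convexity and cancelling the term in
        \<open>f x\<close> leaves the bound at \<open>y\<close>.\<close>
      moreover have "f ((1 - t) *\<^sub>R x + t *\<^sub>R y) = (1 - t) *\<^sub>R f x + t *\<^sub>R (A S *v y + b S)"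
        unfolding mid Ab[OF S inS(1)] Ab[OF S inS(2)]
        by (simp add: algebra_simps matrix_vector_right_distrib matrix_vector_mult_diff_distrib
            matrix_vector_mult_scaleR)
      ultimately have "t * (A S *v y + b S) $ i \<le> t * f y $ i" by simp
      then show ?thesis using t(1) by simp
    qed
    then show ?thesis by (simp add: less_eq_vec_def)
  qed
  show ?thesis
  proof (rule that[of "(\<lambda>S. (A S, b S)) ` \<Q>"])
    show "finite ((\<lambda>S. (A S, b S)) ` \<Q>)" using fin by (simp add: \<Q>_def)
    show "A' *v y + b' \<le> f y" if "(A', b') \<in> (\<lambda>S. (A S, b S)) ` \<Q>" for A' b' y
      using that minorant by auto
    show "\<exists>(A, b)\<in>(\<lambda>S. (A S, b S)) ` \<Q>. f y = A *v y + b" for y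
      using coverQ[of y] Ab by (auto simp: \<Q>_def)
  qed
qed

lemma eventually_mult_le:
  fixes a c :: real
  assumes "0 < a"
  shows "eventually (\<lambda>t. t * c \<le> a) (at_right 0)"
proof -
  have "((\<lambda>t. t * c) \<longlongrightarrow> 0 * c) (at_right 0)" by (intro tendsto_intros)
  then have "eventually (\<lambda>t. t * c < a) (at_right 0)"
    using assms by (intro order_tendstoD(2)) auto
  then show ?thesis by eventually_elim simp
qed

section \<open>Critical arcs stay inside critical classes\<close>

lemma critical_arcs_subset: "critical_arcs f v \<subseteq> critical_nodes f v \<times> critical_nodes f v"
  by (auto simp: critical_arcs_def critical_nodes_def final_arcs_def)

text \<open>An arc comes from a final class of a single \<open>P\<close>, which is strongly
  connected by itself; its return path is therefore made of critical arcs.\<close>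

lemma critical_arcs_sym_rtrancl:
  assumes "(i, j) \<in> critical_arcs f v"
  shows "(j, i) \<in> (critical_arcs f v)\<^sup>*"
proof -
  obtain P where P: "P \<in> subdifferential f v" "(i, j) \<in> final_arcs P"
    using assms by (auto simp: critical_arcs_def)
  have "(i, j) \<in> matrix_graph P" "i \<in> final_nodes P" "j \<in> final_nodes P"
    using P(2) by (auto simp: final_arcs_def)
  then have "(j, i) \<in> (matrix_graph P)\<^sup>*" by (auto simp: mem_final_nodes_iff)
  then have "(j, i) \<in> (final_arcs P)\<^sup>* \<and> i \<in> final_nodes P"
  proof (induction rule: rtrancl_induct)
    case (step k l)
    then have kl: "(k, l) \<in> final_arcs P" by (simp add: mem_final_arcs_iff matrix_graph_def)
    then have "l \<in> final_nodes P" by (simp add: final_arcs_def)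
    with kl step.IH show ?case by (meson rtrancl_into_rtrancl)
  qed (simp add: \<open>j \<in> final_nodes P\<close>)
  moreover have "final_arcs P \<subseteq> critical_arcs f v" using P(1) by (auto simp: critical_arcs_def)
  ultimately show ?thesis using rtrancl_mono by blast
qed

lemma critical_arc_same_class:
  assumes "(i, j) \<in> critical_arcs f v" "K \<in> critical_classes f v"
  shows "i \<in> K \<longleftrightarrow> j \<in> K"
proof -
  have K: "K \<in> graph_classes (critical_nodes f v) (critical_arcs f v)"
    using assms(2) by (simp add: critical_classes_def)
  have N: "i \<in> critical_nodes f v" "j \<in> critical_nodes f v"
    using assms(1) critical_arcs_subset by blast+
  have R: "(i, j) \<in> (critical_arcs f v)\<^sup>*" "(j, i) \<in> (critical_arcs f v)\<^sup>*"
    using assms(1) critical_arcs_sym_rtrancl by blast+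
  show ?thesis
    using graph_classes_closed[OF K _ N(2) R] graph_classes_closed[OF K _ N(1) R(2,1)] by blast
qed

section \<open>Convexity, minima and dimension of the restricted fixed points\<close>

context convex_mh_fixed
begin

lemma restriction_fixed_points_convex:
  "convex (restriction (critical_nodes f v) ` {x. f x = x})"
  unfolding restriction_fixed_points
proof (rule convex_linear_image)
  show "linear (restriction (critical_nodes f v))"
    by (rule linearI) (auto simp: restriction_def vec_eq_iff)
  show "convex {x. f x \<le> x}"
  proof (rule convexI)
    fix x y :: "real ^ 'n" and s t :: real
    assume xy: "x \<in> {x. f x \<le> x}" "y \<in> {x. f x \<le> x}" and st: "0 \<le> s" "0 \<le> t" "s + t = 1"
    have "f (s *\<^sub>R x + t *\<^sub>R y) $ i \<le> s * x $ i + t * y $ i" for i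
    proof -
      have "f (s *\<^sub>R x + t *\<^sub>R y) $ i \<le> s * f x $ i + t * f y $ i"
        using convex_comp[of i] st by (simp add: convex_on_def)
      also have "\<dots> \<le> s * x $ i + t * y $ i"
        using xy st by (intro add_mono mult_left_mono) (auto simp: less_eq_vec_def)
      finally show ?thesis .
    qed
    then show "s *\<^sub>R x + t *\<^sub>R y \<in> {x. f x \<le> x}" by (simp add: less_eq_vec_def)
  qed
qed

lemma restriction_fixed_points_inf:
  assumes "x \<in> restriction (critical_nodes f v) ` {x. f x = x}"
    and "y \<in> restriction (critical_nodes f v) ` {x. f x = x}"
  shows "inf x y \<in> restriction (critical_nodes f v) ` {x. f x = x}"
proof -
  obtain a b where a: "f a = a" "x = restriction (critical_nodes f v) a"
    and b: "f b = b" "y = restriction (critical_nodes f v) b" using assms by auto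
  have "f (inf a b) \<le> f a" "f (inf a b) \<le> f b" by (simp_all add: monoD[OF mono])
  then have "f (inf a b) \<le> inf a b" using a(1) b(1) by simp
  moreover have "inf x y = restriction (critical_nodes f v) (inf a b)"
    using a(2) b(2) by (simp add: vec_eq_iff restriction_def inf_vec_def)
  ultimately show ?thesis unfolding restriction_fixed_points by blast
qed

lemma aff_dim_restriction_fixed_points_le:
  "aff_dim (restriction (critical_nodes f v) ` {x. f x = x}) \<le> int (card (critical_classes f v))"
proof -
  let ?C = "critical_nodes f v" and ?B = "(\<lambda>K. restriction K (vec 1 :: real ^ 'n)) ` critical_classes f v"
  have "restriction ?C x \<in> (+) (restriction ?C v) ` span ?B" if "f x = x" for x
  proof -
    have arc: "(x - v) $ i = (x - v) $ j" if "(i, j) \<in> (critical_arcs f v)\<^sup>*" for i j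
      using that
    proof (induction rule: rtrancl_induct)
      case (step j k)
      then show ?case using superharmonic_const_on_critical_arcs[of x j k] \<open>f x = x\<close> by simp
    qed simp
    have "restriction ?C (x - v) = (\<Sum>K\<in>critical_classes f v. (x - v) $ (SOME i. i \<in> K) *\<^sub>R restriction K (vec 1))"
      unfolding critical_classes_def
      by (rule restriction_eq_sum_graph_classes, rule arc, rule graph_classes_connected)
    also have "\<dots> \<in> span ?B" by (intro span_sum span_scale span_base imageI)
    finally have "restriction ?C (x - v) \<in> span ?B" .
    moreover have "restriction ?C x = restriction ?C v + restriction ?C (x - v)"
      by (simp add: restriction_def vec_eq_iff)
    ultimately show ?thesis by blast
  qed
  then have "aff_dim (restriction ?C ` {x. f x = x}) \<le> aff_dim ((+) (restriction ?C v) ` span ?B)"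
    by (intro aff_dim_subset) auto
  also have "\<dots> = int (dim ?B)" by (simp add: aff_dim_translation_eq aff_dim_subspace)
  also have "\<dots> \<le> int (card ?B)" by (simp add: dim_le_card')
  also have "\<dots> \<le> int (card (critical_classes f v))" by (simp add: card_image_le)
  finally show ?thesis .
qed

text \<open>By Farkas' lemma, a row that is tight on the whole cone of superharmonic vectors belongs to
  a stationary system of rows, hence to a final class of some element of the subdifferential.\<close>

lemma critical_if_tight:
  fixes G :: "'n \<Rightarrow> (real ^ 'n) set"
  assumes fin: "\<And>i. finite (G i)" and sub: "\<And>i q. q \<in> G i \<Longrightarrow> subgradient (\<lambda>x. f x $ i) v q"
    and q0: "q0 \<in> G i0"
    and tight: "\<And>w. (\<And>i q. q \<in> G i \<Longrightarrow> q \<bullet> w \<le> w $ i) \<Longrightarrow> w $ i0 \<le> q0 \<bullet> w"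
    and j: "q0 $ j \<noteq> 0"
  shows "(i0, j) \<in> critical_arcs f v"
proof -
  \<comment> \<open>The pair \<open>(i, q)\<close> encodes the constraint
    \<open>q \<bullet> w \<le> w $ i\<close> as a linear form.\<close>
  define g where "g k = snd k - axis (fst k) 1" for k :: "'n \<times> (real ^ 'n)"
  let ?I = "Sigma UNIV G"
  have ginner: "g k \<bullet> w = snd k \<bullet> w - w $ fst k" for k w
    by (simp add: g_def inner_diff_left inner_axis')
  have finI: "finite ?I" using fin by auto
  have neg: "(- g (i0, q0)) \<bullet> w \<le> 0" if w: "\<And>k. k \<in> ?I \<Longrightarrow> g k \<bullet> w \<le> 0" for w
  proof -
    have "w $ i0 \<le> q0 \<bullet> w"
    proof (rule tight)
      show "q \<bullet> w \<le> w $ i" if "q \<in> G i" for i q using w[of "(i, q)"] that by (simp add: ginner)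
    qed
    then show ?thesis by (simp add: ginner)
  qed
  obtain c where c: "\<And>k. 0 \<le> (c k :: real)" "- g (i0, q0) = (\<Sum>k\<in>?I. c k *\<^sub>R g k)"
    using farkas[OF finI neg] by blast
  \<comment> \<open>Farkas writes \<open>- g (i0, q0)\<close> as a conic combination; moving it
    across gives a vanishing one with weight at least 1 on \<open>(i0, q0)\<close>.\<close>
  define d where "d k = c k + (if k = (i0, q0) then 1 else 0)" for k
  have d0: "0 \<le> d k" "0 < d (i0, q0)" for k
    using c(1)[of k] c(1)[of "(i0, q0)"] by (auto simp: d_def)
  have "(\<Sum>k\<in>?I. d k *\<^sub>R g k) = (\<Sum>k\<in>?I. c k *\<^sub>R g k) + (\<Sum>k\<in>?I. if k = (i0, q0) then g k else 0)"
    unfolding d_def scaleR_left_distrib sum.distrib by (intro arg_cong2[of _ _ _ _ "(+)"] sum.cong) auto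
  also have "\<dots> = 0" using finI q0 by (simp add: c(2)[symmetric])
  finally have sum0: "(\<Sum>k\<in>?I. d k *\<^sub>R g k) = 0" .
  \<comment> \<open>Weights grouped by row: \<open>m $ i\<close> is the mass of row
    \<open>i\<close>, and \<open>R i\<close> divided by it is a convex combination of subgradients.
    The vanishing sum then says that \<open>m\<close> is stationary.\<close>
  define m where "m = (\<chi> i. \<Sum>q\<in>G i. d (i, q))"
  define R where "R i = (\<Sum>q\<in>G i. d (i, q) *\<^sub>R q)" for i
  have m0: "0 \<le> m $ i" for i by (simp add: m_def sum_nonneg d0)
  have "\<exists>q. subgradient (\<lambda>x. f x $ i) v q" for i
    using subgradient_exists[OF convex_comp] by blast
  then obtain p where p: "\<And>i. subgradient (\<lambda>x. f x $ i) v (p i)" by metis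
  \<comment> \<open>Rows without mass cannot be normalised, so they receive an arbitrary
    subgradient.\<close>
  define P where "P = (\<chi> i. if m $ i = 0 then p i else (1 / m $ i) *\<^sub>R R i)"
  have mP: "m $ i *\<^sub>R P $ i = R i" for i
  proof (cases "m $ i = 0")
    case True
    then have "\<forall>q\<in>G i. d (i, q) = 0"
      using fin d0 by (simp add: m_def sum_nonneg_eq_0_iff)
    then show ?thesis using True by (simp add: R_def)
  qed (simp add: P_def)
  have "P \<in> subdifferential f v"
    unfolding mem_subdifferential_iff
  proof
    fix i
    show "subgradient (\<lambda>x. f x $ i) v (P $ i)"
    proof (cases "m $ i = 0")
      case False
      have "(P $ i) \<bullet> (y - v) \<le> f y $ i - f v $ i" for y
      proof -
        have "m $ i * ((P $ i) \<bullet> (y - v)) = R i \<bullet> (y - v)"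
          by (simp flip: mP)
        also have "\<dots> = (\<Sum>q\<in>G i. d (i, q) * (q \<bullet> (y - v)))"
          by (simp add: R_def inner_sum_left)
        also have "\<dots> \<le> (\<Sum>q\<in>G i. d (i, q) * (f y $ i - f v $ i))"
          using sub d0 by (intro sum_mono mult_left_mono) (auto simp: subgradient_def)
        also have "\<dots> = m $ i * (f y $ i - f v $ i)"
          by (simp add: m_def sum_distrib_right)
        finally show ?thesis using False m0[of i] by (simp add: less_le)
      qed
      then show ?thesis by (simp add: subgradient_def)
    qed (simp add: P_def p)
  qed
  have "(m v* P) $ j = m $ j" for j
  proof -
    have "(m v* P) $ j = (\<Sum>i\<in>UNIV. (m $ i *\<^sub>R P $ i) $ j)"
      by (simp add: vector_matrix_mult_def)
    also have "\<dots> = (\<Sum>i\<in>UNIV. \<Sum>q\<in>G i. d (i, q) * q $ j)"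
      unfolding mP by (simp add: R_def sum_component)
    finally have 1: "(m v* P) $ j = (\<Sum>i\<in>UNIV. \<Sum>q\<in>G i. d (i, q) * q $ j)" .
    have "0 = (\<Sum>k\<in>?I. d k *\<^sub>R g k) $ j" by (simp add: sum0)
    also have "\<dots> = (\<Sum>i\<in>UNIV. \<Sum>q\<in>G i. d (i, q) * (q $ j - axis i 1 $ j))"
      using fin by (subst sum.Sigma) (auto simp: sum_component g_def split_beta intro!: sum.cong)
    also have "\<dots> = (m v* P) $ j - (\<Sum>i\<in>UNIV. \<Sum>q\<in>G i. d (i, q) * axis i 1 $ j)"
      unfolding 1 by (simp add: right_diff_distrib sum_subtractf)
    also have "(\<Sum>i\<in>UNIV. \<Sum>q\<in>G i. d (i, q) * axis i 1 $ j) = (\<Sum>i\<in>UNIV. if i = j then m $ i else 0)"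
      by (intro sum.cong refl) (auto simp: m_def axis_def)
    finally show ?thesis by simp
  qed
  then have "m v* P = m" by (simp add: vec_eq_iff)
  moreover have mpos: "0 < m $ i0"
  proof -
    have "d (i0, q0) \<le> m $ i0" unfolding m_def using fin q0 d0
      by simp (rule member_le_sum[of q0 "G i0" "\<lambda>q. d (i0, q)"], auto)
    then show ?thesis using d0(2) by simp
  qed
  ultimately have "i0 \<in> final_nodes P"
    using final_node_if_stationary[of P m i0] subdifferential_stochastic[OF \<open>P \<in> subdifferential f v\<close>] m0 by blast
  moreover have "P $ i0 $ j \<noteq> 0"
  proof -
    have nn: "0 \<le> q $ j" if "q \<in> G i0" for q
      using subgradient_stochastic[OF sub[OF that]] by (simp add: stochastic_def)
    have "0 < d (i0, q0) * q0 $ j" using d0(2) nn[OF q0] j by simp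
    also have "\<dots> \<le> R i0 $ j"
      unfolding R_def sum_component using fin q0 d0 nn
      by simp (rule member_le_sum[of q0 "G i0" "\<lambda>q. d (i0, q) * q $ j"], auto)
    also have "\<dots> = m $ i0 * P $ i0 $ j" by (simp flip: mP)
    finally show ?thesis by auto
  qed
  ultimately show ?thesis
    using \<open>P \<in> subdifferential f v\<close> by (auto simp: critical_arcs_def mem_final_arcs_iff)
qed

text \<open>A row that uses a noncritical arc is not tight on the whole cone, so some element of the
  cone is strict for it. Summing such elements over all rows gives strictness for all of them at
  once.\<close>

lemma strictly_superharmonic_off_critical_arcs:
  fixes G :: "'n \<Rightarrow> (real ^ 'n) set"
  assumes fin: "\<And>i. finite (G i)" and sub: "\<And>i q. q \<in> G i \<Longrightarrow> subgradient (\<lambda>x. f x $ i) v q"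
  obtains w where "\<And>i q. q \<in> G i \<Longrightarrow> q \<bullet> w \<le> w $ i"
    and "\<And>i q j. q \<in> G i \<Longrightarrow> q \<bullet> w = w $ i \<Longrightarrow> q $ j \<noteq> 0 \<Longrightarrow> (i, j) \<in> critical_arcs f v"
proof -
  let ?I = "Sigma UNIV G"
  have "\<exists>w. (\<forall>i. \<forall>q\<in>G i. q \<bullet> w \<le> w $ i) \<and>
      (k \<in> ?I \<longrightarrow> snd k \<bullet> w = w $ fst k \<longrightarrow> (\<forall>j. snd k $ j \<noteq> 0 \<longrightarrow> (fst k, j) \<in> critical_arcs f v))" for k
  proof (cases "\<exists>w. (\<forall>i. \<forall>q\<in>G i. q \<bullet> w \<le> w $ i) \<and> snd k \<bullet> w \<noteq> w $ fst k")
    case False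
    have "(fst k, j) \<in> critical_arcs f v" if "k \<in> ?I" "snd k $ j \<noteq> 0" for j
    proof (rule critical_if_tight[OF fin sub _ _ that(2)])
      show "snd k \<in> G (fst k)" using that(1) by auto
      show "w $ fst k \<le> snd k \<bullet> w" if "\<And>i q. q \<in> G i \<Longrightarrow> q \<bullet> w \<le> w $ i" for w
        using False that by fastforce
    qed
    then show ?thesis by (intro exI[of _ 0]) auto
  qed blast
  then obtain W where W: "\<And>k i q. q \<in> G i \<Longrightarrow> q \<bullet> W k \<le> W k $ i"
    and Wc: "\<And>k j. k \<in> ?I \<Longrightarrow> snd k \<bullet> W k = W k $ fst k \<Longrightarrow> snd k $ j \<noteq> 0 \<Longrightarrow> (fst k, j) \<in> critical_arcs f v"
    by metis
  define w where "w = (\<Sum>k\<in>?I. W k)"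
  have finI: "finite ?I" using fin by auto
  have eq: "w $ i - q \<bullet> w = (\<Sum>k\<in>?I. W k $ i - q \<bullet> W k)" for i q
    by (simp add: w_def sum_component inner_sum_right sum_subtractf)
  have "q \<bullet> w \<le> w $ i" if "q \<in> G i" for i q
  proof -
    have "0 \<le> w $ i - q \<bullet> w" unfolding eq using W[OF that] by (intro sum_nonneg) simp
    then show ?thesis by simp
  qed
  moreover have "(i, j) \<in> critical_arcs f v" if q: "q \<in> G i" "q \<bullet> w = w $ i" "q $ j \<noteq> 0" for i q j
  proof -
    have "(\<Sum>k\<in>?I. W k $ i - q \<bullet> W k) = 0" using q(2) eq[of i q] by simp
    then have "W (i, q) $ i - q \<bullet> W (i, q) = 0"
      using W[OF q(1)] finI q(1) by (subst (asm) sum_nonneg_eq_0_iff) auto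
    then show ?thesis using Wc[of "(i, q)" j] q by simp
  qed
  ultimately show ?thesis using that by blast
qed

text \<open>Two scales: \<open>\<eta>\<close> is so small that class indicators can be added to
  \<open>w\<close> without violating the active rows, then \<open>\<epsilon>\<close> so small that
  the inactive rows are protected by their slack.\<close>

lemma aff_dim_restriction_fixed_points_ge:
  assumes "piecewise_affine f"
  shows "int (card (critical_classes f v)) \<le> aff_dim (restriction (critical_nodes f v) ` {x. f x = x})"
proof -
  let ?C = "critical_nodes f v"
  obtain J where finJ: "finite J" and J: "\<And>A b y. (A, b) \<in> J \<Longrightarrow> A *v y + b \<le> f y"
    and Jmax: "\<And>y. \<exists>(A, b)\<in>J. f y = A *v y + b"
    using convex_piecewise_affine_eq_max[OF convex assms] by blast
  \<comment> \<open>Slack of the affine piece \<open>k\<close> in coordinate \<open>i\<close> at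
    \<open>v\<close>; the pieces with zero slack supply the rows in \<open>G\<close>.\<close>
  define s where "s i k = v $ i - (fst k *v v + snd k) $ i" for i and k :: "(real ^ 'n ^ 'n) \<times> (real ^ 'n)"
  have s0: "0 \<le> s i k" if "k \<in> J" for i k
    using J[of "fst k" "snd k" v] that fixed by (simp add: s_def less_eq_vec_def)
  define G where "G i = {fst k $ i | k. k \<in> J \<and> s i k = 0}" for i
  have "G i \<subseteq> (\<lambda>k. fst k $ i) ` J" for i unfolding G_def by blast
  then have finG: "finite (G i)" for i by (rule finite_subset) (simp add: finJ)
  have subG: "subgradient (\<lambda>x. f x $ i) v q" if "q \<in> G i" for i q
    unfolding subgradient_def
  proof
    fix y
    obtain k where k: "k \<in> J" "s i k = 0" "q = fst k $ i" using \<open>q \<in> G i\<close> by (auto simp: G_def)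
    have "(fst k *v y + snd k) $ i \<le> f y $ i"
      using J[of "fst k" "snd k" y] k(1) by (simp add: less_eq_vec_def)
    then show "q \<bullet> (y - v) \<le> f y $ i - f v $ i"
      using k(2) by (simp add: s_def k(3) matrix_vector_mul_component inner_diff_right fixed)
  qed
  obtain w where w: "\<And>i q. q \<in> G i \<Longrightarrow> q \<bullet> w \<le> w $ i"
    and wc: "\<And>i q j. q \<in> G i \<Longrightarrow> q \<bullet> w = w $ i \<Longrightarrow> q $ j \<noteq> 0 \<Longrightarrow> (i, j) \<in> critical_arcs f v"
    using strictly_superharmonic_off_critical_arcs[of G, OF finG subG] by blast
  \<comment> \<open>0 is included so that the base point \<open>p\<close> is covered together with
    its translates.\<close>
  define U where "U = insert 0 ((\<lambda>K. restriction K (vec 1 :: real ^ 'n)) ` critical_classes f v)"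
  have finU: "finite U" by (simp add: U_def)
  have U: "u $ i = u $ j" if "u \<in> U" "(i, j) \<in> critical_arcs f v" for u i j
    using that critical_arc_same_class[OF that(2)] by (auto simp: U_def restriction_def)
  have "eventually (\<lambda>t. \<forall>i. \<forall>q\<in>G i. \<forall>u\<in>U. t * (q \<bullet> u - u $ i) \<le> w $ i - q \<bullet> w) (at_right 0)"
  proof (intro eventually_all_finite eventually_ball_finite ballI finG finU)
    fix i q u assume q: "q \<in> G i" and u: "u \<in> U"
    show "eventually (\<lambda>t. t * (q \<bullet> u - u $ i) \<le> w $ i - q \<bullet> w) (at_right 0)"
    proof (cases "q \<bullet> w = w $ i")
      case True
      \<comment> \<open>A row without strictness uses only critical arcs, along which
        \<open>u\<close> is constant, so the perturbation costs nothing.\<close>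
      have "q \<bullet> u = u $ i"
        using wc[OF q True] U[OF u]
        by (intro stochastic_inner_const[OF subgradient_stochastic[OF subG[OF q]]]) metis
      then show ?thesis using True by simp
    next
      case False
      then show ?thesis using w[OF q] by (intro eventually_mult_le) simp
    qed
  qed
  then have "eventually (\<lambda>t. (\<forall>i. \<forall>q\<in>G i. \<forall>u\<in>U. t * (q \<bullet> u - u $ i) \<le> w $ i - q \<bullet> w) \<and> 0 < t) (at_right 0)"
    by (intro eventually_conj eventually_at_right_less)
  from eventually_happens'[OF trivial_limit_at_right_real this] obtain \<eta> where \<eta>: "0 < \<eta>" "\<And>i q u. q \<in> G i \<Longrightarrow> u \<in> U \<Longrightarrow> \<eta> * (q \<bullet> u - u $ i) \<le> w $ i - q \<bullet> w"
    by blast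
  define z where "z u = w + \<eta> *\<^sub>R u" for u
  have zG: "q \<bullet> z u \<le> z u $ i" if "q \<in> G i" "u \<in> U" for i q u
    using \<eta>(2)[OF that] by (simp add: z_def inner_add_right algebra_simps)
  have "eventually (\<lambda>t. (\<forall>i. \<forall>k\<in>J. \<forall>u\<in>U. t * ((fst k $ i) \<bullet> z u - z u $ i) \<le> s i k) \<and> 0 < t) (at_right 0)"
  proof (intro eventually_conj eventually_at_right_less eventually_all_finite eventually_ball_finite ballI finJ finU)
    fix i k u assume k: "k \<in> J" and u: "u \<in> U"
    show "eventually (\<lambda>t. t * ((fst k $ i) \<bullet> z u - z u $ i) \<le> s i k) (at_right 0)"
    proof (cases "s i k = 0")
      case True
      then have "fst k $ i \<in> G i" using k unfolding G_def by blast
      then have "(fst k $ i) \<bullet> z u - z u $ i \<le> 0" using zG u by simp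
      then have "t * ((fst k $ i) \<bullet> z u - z u $ i) \<le> s i k" if "0 < t" for t
        using that True by (simp add: mult_nonneg_nonpos)
      then show ?thesis
        by (intro eventually_mono[OF eventually_at_right_less[of 0]])
    next
      case False
      then show ?thesis using s0[OF k, of i] by (intro eventually_mult_le) simp
    qed
  qed
  from eventually_happens'[OF trivial_limit_at_right_real this] obtain \<epsilon> where \<epsilon>: "0 < \<epsilon>" "\<And>i k u. k \<in> J \<Longrightarrow> u \<in> U \<Longrightarrow> \<epsilon> * ((fst k $ i) \<bullet> z u - z u $ i) \<le> s i k"
    by blast
  have super: "f (v + \<epsilon> *\<^sub>R z u) \<le> v + \<epsilon> *\<^sub>R z u" if u: "u \<in> U" for u
  proof -
    obtain k where k: "k \<in> J" "f (v + \<epsilon> *\<^sub>R z u) = fst k *v (v + \<epsilon> *\<^sub>R z u) + snd k"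
      using Jmax[of "v + \<epsilon> *\<^sub>R z u"] by auto
    have "f (v + \<epsilon> *\<^sub>R z u) $ i \<le> (v + \<epsilon> *\<^sub>R z u) $ i" for i
      using \<epsilon>(2)[OF k(1) u, of i] unfolding k(2)
      by (simp add: s_def matrix_vector_mul_component inner_add_right algebra_simps)
    then show ?thesis by (simp add: less_eq_vec_def)
  qed
  define p where "p = restriction ?C (v + \<epsilon> *\<^sub>R z 0)"
  let ?B = "(\<lambda>K. (\<epsilon> * \<eta>) *\<^sub>R restriction K (vec 1 :: real ^ 'n)) ` critical_classes f v"
  have "0 \<in> U" by (simp add: U_def)
  then have pS: "p \<in> restriction ?C ` {x. f x = x}"
    unfolding restriction_fixed_points p_def using super by blast
  have "p + b \<in> restriction ?C ` {x. f x = x}" if bB: "b \<in> ?B" for b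
  proof -
    obtain K where K: "K \<in> critical_classes f v" and b: "b = (\<epsilon> * \<eta>) *\<^sub>R restriction K (vec 1)"
      using bB by auto
    have "K \<subseteq> ?C"
      using K Union_graph_classes[of ?C "critical_arcs f v"] by (auto simp: critical_classes_def)
    then have "p + b = restriction ?C (v + \<epsilon> *\<^sub>R z (restriction K (vec 1)))"
      by (auto simp: p_def b z_def restriction_def vec_eq_iff algebra_simps)
    moreover have "restriction K (vec 1) \<in> U" using K by (simp add: U_def)
    ultimately show ?thesis
      unfolding restriction_fixed_points using super by blast
  qed
  moreover have "\<epsilon> * \<eta> \<noteq> 0" using \<epsilon>(1) \<eta>(1) by simp
  ultimately show ?thesis
    using card_le_aff_dim[OF indicator_graph_classes(1) pS, of "\<epsilon> * \<eta>" ?C "critical_arcs f v"]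
      indicator_graph_classes(2)[of "\<epsilon> * \<eta>" ?C "critical_arcs f v"]
    by (simp add: critical_classes_def)
qed

end

section \<open>Cyclicity\<close>

lemma numerical_semigroup_eventually:
  fixes S :: "nat set"
  assumes zero: "0 \<in> S" and add: "\<And>a b. a \<in> S \<Longrightarrow> b \<in> S \<Longrightarrow> a + b \<in> S" and c: "Gcd S dvd c"
  obtains R where "\<And>r. R \<le> r \<Longrightarrow> r * c \<in> S"
proof (cases "c = 0")
  case True
  then show ?thesis using that zero by auto
next
  case False
  have mult: "n * a \<in> S" if "a \<in> S" for n a
    by (induction n) (auto simp: zero intro: add that)
  have "\<exists>s\<in>S. s \<noteq> 0"
  proof (rule ccontr)
    assume "\<not> (\<exists>s\<in>S. s \<noteq> 0)"
    then have "S = {0}" using zero by auto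
    with c False show False by simp
  qed
  then have ex: "\<exists>e. 0 < e \<and> (\<exists>b\<in>S. b + e \<in> S)" using zero by (metis add_0 gr0I)
  \<comment> \<open>the least positive difference of two elements of \<open>S\<close> divides all of \<open>S\<close>\<close>
  define e where "e = (LEAST e. 0 < e \<and> (\<exists>b\<in>S. b + e \<in> S))"
  have "0 < e \<and> (\<exists>b\<in>S. b + e \<in> S)" unfolding e_def by (rule LeastI_ex[OF ex])
  then obtain b where e: "0 < e" and b: "b \<in> S" "b + e \<in> S" by blast
  have least: "e \<le> r" if "0 < r" "a \<in> S" "a + r \<in> S" for r a
    unfolding e_def using that by (intro Least_le) auto
  have "e dvd s" if s: "s \<in> S" for s
  proof -
    \<comment> \<open>Adding copies of \<open>b\<close> exhibits \<open>s mod e\<close> as a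
      difference of two elements of \<open>S\<close>, so minimality of \<open>e\<close> forces it to
      vanish.\<close>
    have "s + (s div e) * b = (s div e) * (b + e) + s mod e"
      by (simp add: algebra_simps)
    then have "(s div e) * (b + e) + s mod e \<in> S" using add[OF s mult[OF b(1)]] by metis
    then have "\<not> 0 < s mod e"
      using least[of "s mod e" "(s div e) * (b + e)"] mult[OF b(2)] e by (metis mod_less_divisor not_le)
    then show ?thesis by (simp add: dvd_eq_mod_eq_0)
  qed
  then have "e dvd Gcd S" by (rule Gcd_greatest)
  then obtain t where t: "c = e * t" using c dvd_trans by blast
  obtain q where q: "b = e * q" using \<open>\<And>s. s \<in> S \<Longrightarrow> e dvd s\<close> b(1) by blast
  \<comment> \<open>For positive \<open>q\<close>, combines \<open>l\<close> copies of
    \<open>b\<close> and \<open>s\<close> copies of \<open>b + e\<close>, with \<open>s\<close> the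
    remainder of \<open>n\<close> modulo \<open>q\<close>; \<open>q * q \<le> n\<close> makes the
    quotient at least \<open>q\<close>, hence larger than \<open>s\<close>.\<close>
  have multiples: "n * e \<in> S" if n: "q * q \<le> n" for n
  proof (cases "q = 0")
    case True
    then show ?thesis using mult[OF b(2), of n] q by simp
  next
    case False
    define m s where "m = n div q" and "s = n mod q"
    have "s < q" "q \<le> m" using False n by (auto simp: m_def s_def less_eq_div_iff_mult_less_eq)
    then obtain l where l: "m = s + l" using le_Suc_ex[of s m] by auto
    have "n = q * m + s" by (simp add: m_def s_def)
    then have "n * e = l * b + s * (b + e)" by (simp add: l q algebra_simps)
    then show ?thesis using add mult b by metis
  qed
  have "1 \<le> t" using False t by (cases t) auto
  have "r * c \<in> S" if "q * q \<le> r" for r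
  proof -
    have "q * q \<le> r * t" using that \<open>1 \<le> t\<close> by (metis le_trans mult_le_mono2 mult.right_neutral)
    then show ?thesis using multiples[of "r * t"] by (simp add: t ac_simps)
  qed
  then show ?thesis by (rule that)
qed

lemma relpow_subset:
  fixes E E' :: "'a rel"
  assumes "E \<subseteq> E'" shows "E ^^ k \<subseteq> E' ^^ k"
  by (induction k) (simp_all add: assms relcomp_mono)

text \<open>The return lengths of \<open>i\<close> form a semigroup. Going to \<open>j\<close> and
  back, with or without a circuit at \<open>j\<close>, shows that their gcd divides the length of
  every circuit in the class, hence the class cyclicity.\<close>

lemma circuits_of_large_length:
  assumes K: "K \<in> graph_classes N E" "i \<in> K" and c: "class_cyclicity E K dvd c"
  obtains R where "\<And>r. R \<le> r \<Longrightarrow> (i, i) \<in> E ^^ (r * c)"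
proof -
  define S where "S = {k. (i, i) \<in> E ^^ k}"
  have add: "a + b \<in> S" if "a \<in> S" "b \<in> S" for a b
    using that by (auto simp: S_def relpow_add)
  have "Gcd S dvd class_cyclicity E K"
    unfolding class_cyclicity_def
  proof (rule Gcd_greatest)
    fix k assume "k \<in> {k. k > 0 \<and> (\<exists>i\<in>K. (i, i) \<in> (E \<inter> K \<times> K) ^^ k)}"
    then obtain j where j: "j \<in> K" "(j, j) \<in> (E \<inter> K \<times> K) ^^ k" by blast
    have "(j, j) \<in> E ^^ k" using j(2) relpow_subset[of "E \<inter> K \<times> K" E k] by blast
    moreover obtain a where "(i, j) \<in> E ^^ a"
      using graph_classes_connected[OF K j(1)] by (auto simp: rtrancl_power)
    moreover obtain b where "(j, i) \<in> E ^^ b"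
      using graph_classes_connected[OF K(1) j(1) K(2)] by (auto simp: rtrancl_power)
    ultimately have "a + b \<in> S" "a + k + b \<in> S" by (auto simp: S_def relpow_add)
    then have "Gcd S dvd a + b" "Gcd S dvd (a + b) + k" by (auto intro: Gcd_dvd simp: ac_simps)
    then show "Gcd S dvd k" by (simp add: dvd_add_right_iff)
  qed
  then have "Gcd S dvd c" using c by (rule dvd_trans)
  moreover have "0 \<in> S" by (simp add: S_def)
  ultimately obtain R where "\<And>r. R \<le> r \<Longrightarrow> r * c \<in> S"
    using numerical_semigroup_eventually[of S c] add by blast
  then have "\<And>r. R \<le> r \<Longrightarrow> (i, i) \<in> E ^^ (r * c)" by (simp add: S_def)
  then show ?thesis by (rule that)
qed

section \<open>Limit sets of orbits\<close>

text \<open>For an orbit this is its omega-limit set.\<close>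

definition limit_points :: "(nat \<Rightarrow> 'a::topological_space) \<Rightarrow> 'a set" where
  "limit_points s = {l. \<exists>r. strict_mono r \<and> (\<lambda>k. s (r k)) \<longlonglongrightarrow> l}"

text \<open>Subsequences suit the dynamics; the intersection of closures gives closedness.\<close>

lemma limit_points_eq_Inter_closure:
  fixes s :: "nat \<Rightarrow> 'a::metric_space"
  shows "limit_points s = (\<Inter>n. closure (s ` {n..}))"
proof (intro equalityI subsetI)
  fix l assume "l \<in> limit_points s"
  then obtain r where r: "strict_mono r" "(\<lambda>k. s (r k)) \<longlonglongrightarrow> l" by (auto simp: limit_points_def)
  have "l \<in> closure (s ` {n..})" for n
  proof (rule Lim_in_closed_set[OF closed_closure _ _ r(2)])
    have "s (r k) \<in> closure (s ` {n..})" if "n \<le> k" for k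
      using that seq_suble[OF r(1), of k] closure_subset by (intro subsetD[OF closure_subset] imageI) simp
    then show "eventually (\<lambda>k. s (r k) \<in> closure (s ` {n..})) sequentially"
      by (auto simp: eventually_sequentially)
  qed simp
  then show "l \<in> (\<Inter>n. closure (s ` {n..}))" by blast
next
  fix l assume l: "l \<in> (\<Inter>n. closure (s ` {n..}))"
  have near: "\<exists>k\<ge>n. dist (s k) l < e" if "0 < e" for n and e :: real
    using l that closure_approachable[of l "s ` {n..}"] by auto
  have "\<exists>r. \<forall>m. dist (s (r m)) l < inverse (real (Suc m)) \<and> r m < r (Suc m)"
  proof (rule dependent_nat_choice)
    show "\<exists>k. dist (s k) l < inverse (real (Suc 0))" using near[of 1 0] by auto
    show "\<exists>k'. dist (s k') l < inverse (real (Suc (Suc m))) \<and> k < k'" for k m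
      using near[of "inverse (real (Suc (Suc m)))" "Suc k"] by auto
  qed
  then obtain r where r: "\<And>m. dist (s (r m)) l < inverse (real (Suc m))" "strict_mono r"
    by (auto simp: strict_mono_Suc_iff)
  have "(\<lambda>m. dist (s (r m)) l) \<longlonglongrightarrow> 0"
  proof (rule tendsto_sandwich[OF _ _ tendsto_const LIMSEQ_inverse_real_of_nat])
    show "eventually (\<lambda>m. dist (s (r m)) l \<le> inverse (real (Suc m))) sequentially"
      by (intro always_eventually allI less_imp_le r(1))
  qed simp
  then have "(\<lambda>m. s (r m)) \<longlonglongrightarrow> l" by (simp add: tendsto_dist_iff[symmetric])
  then show "l \<in> limit_points s" using r(2) by (auto simp: limit_points_def)
qed

lemma compact_limit_points:
  fixes s :: "nat \<Rightarrow> 'a::heine_borel"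
  assumes "bounded (range s)"
  shows "compact (limit_points s)"
proof -
  have "closed (limit_points s)"
    unfolding limit_points_eq_Inter_closure by (intro closed_INT ballI closed_closure)
  moreover have "limit_points s \<subseteq> closure (range s)"
    unfolding limit_points_eq_Inter_closure using closure_mono[of "s ` {0..}" "range s"] by blast
  ultimately show ?thesis
    using assms bounded_closure bounded_subset compact_eq_bounded_closed by blast
qed

lemma limit_points_nonempty:
  fixes s :: "nat \<Rightarrow> 'a::heine_borel"
  assumes "bounded (range s)"
  obtains l r where "strict_mono r" "(\<lambda>k. s (r k)) \<longlonglongrightarrow> l" "l \<in> limit_points s"
  using bounded_imp_convergent_subsequence[OF assms] by (auto simp: limit_points_def comp_def)

section \<open>Periodicity on limit sets and convergence\<close>

context convex_mh_fixed
begin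

lemma iterate_fixed: "(f ^^ k) v = v"
  by (induction k) (simp_all add: fixed)

lemma bounded_orbit: "bounded (range (\<lambda>k. (f ^^ k) x))"
proof -
  have bd: "\<bar>(f ^^ k) x $ i\<bar> \<le> norm (x - v) + \<bar>v $ i\<bar>" for k i
  proof -
    have "(f ^^ k) x $ i \<le> norm (x - v) + (f ^^ k) v $ i"
      by (rule iterate_shift_le) (use component_le_norm_cart[of "x - v"] in \<open>simp add: abs_le_iff algebra_simps\<close>)
    moreover have "(f ^^ k) v $ i \<le> norm (x - v) + (f ^^ k) x $ i"
    proof (rule iterate_shift_le)
      show "v $ j \<le> norm (x - v) + x $ j" for j
        using component_le_norm_cart[of "x - v" j] by (simp add: abs_le_iff)
    qed
    ultimately show ?thesis by (simp add: iterate_fixed)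
  qed
  have "norm ((f ^^ k) x) \<le> (\<Sum>i\<in>UNIV. norm (x - v) + \<bar>v $ i\<bar>)" for k
    by (rule order_trans[OF norm_le_l1_cart sum_mono]) (rule bd)
  then show ?thesis by (auto simp: bounded_iff)
qed

lemma map_limit_points:
  assumes "y \<in> limit_points (\<lambda>k. (f ^^ k) x)"
  shows "f y \<in> limit_points (\<lambda>k. (f ^^ k) x)"
proof -
  obtain r where r: "strict_mono r" "(\<lambda>k. (f ^^ r k) x) \<longlonglongrightarrow> y"
    using assms by (auto simp: limit_points_def)
  have "(\<lambda>k. (f ^^ Suc (r k)) x) \<longlonglongrightarrow> f y" using tendsto_map[OF r(2)] by simp
  moreover have "strict_mono (\<lambda>k. Suc (r k))" using r(1) by (simp add: strict_mono_def)
  ultimately show ?thesis unfolding limit_points_def by blast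
qed

text \<open>Predecessors of the terms converging to \<open>y\<close> stay bounded, so some
  subsequence of them converges, and continuity sends its limit to \<open>y\<close>.\<close>

lemma limit_points_subset_image:
  "limit_points (\<lambda>k. (f ^^ k) x) \<subseteq> f ` limit_points (\<lambda>k. (f ^^ k) x)"
proof
  fix y assume "y \<in> limit_points (\<lambda>k. (f ^^ k) x)"
  then obtain r where r: "strict_mono r" "(\<lambda>k. (f ^^ r k) x) \<longlonglongrightarrow> y"
    by (auto simp: limit_points_def)
  \<comment> \<open>\<open>r (Suc k)\<close> is positive, so the subtraction is genuine.\<close>
  define p where "p k = r (Suc k) - 1" for k
  have p: "Suc (p k) = r (Suc k)" for k
    using seq_suble[OF r(1), of "Suc k"] by (simp add: p_def)
  have "bounded (range (\<lambda>k. (f ^^ p k) x))"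
    by (rule bounded_subset[OF bounded_orbit]) auto
  then obtain z q where q: "strict_mono q" "(\<lambda>k. (f ^^ p (q k)) x) \<longlonglongrightarrow> z"
    by (rule limit_points_nonempty)
  have "strict_mono (\<lambda>k. p (q k))"
  proof (rule strict_monoI)
    fix k l :: nat assume "k < l"
    then have "r (Suc (q k)) < r (Suc (q l))" using q(1) r(1) by (simp add: strict_mono_def)
    then show "p (q k) < p (q l)" by (simp flip: p)
  qed
  then have "z \<in> limit_points (\<lambda>k. (f ^^ k) x)" using q(2) unfolding limit_points_def by blast
  moreover have "f z = y"
  proof (rule LIMSEQ_unique)
    show "(\<lambda>k. (f ^^ r (Suc (q k))) x) \<longlonglongrightarrow> f z"
      using tendsto_map[OF q(2)] by (simp flip: p)
    have "strict_mono (\<lambda>k. Suc (q k))" using q(1) by (simp add: strict_mono_def)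
    then show "(\<lambda>k. (f ^^ r (Suc (q k))) x) \<longlonglongrightarrow> y"
      using LIMSEQ_subseq_LIMSEQ[OF r(2)] by (simp add: comp_def)
  qed
  ultimately show "y \<in> f ` limit_points (\<lambda>k. (f ^^ k) x)" by blast
qed

text \<open>A stationary vector of \<open>P\<close> increases along the orbit, so it is constant on the limit set;
  there the subgradient inequality is an equality on the support of the stationary vector.\<close>

lemma affine_on_limit_points:
  assumes y: "y \<in> limit_points (\<lambda>k. (f ^^ k) x)" and P: "P \<in> subdifferential f v"
    and i: "i \<in> final_nodes P"
  shows "f y $ i = v $ i + (P $ i) \<bullet> (y - v)"
proof -
  obtain m where m: "\<And>j. 0 \<le> m $ j" "m v* P = m" "0 < m $ i"
    using stationary_if_final_node[OF subdifferential_stochastic[OF P] i] by blast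
  define gap where "gap z = (f z - v) - P *v (z - v)" for z
  have gap0: "0 \<le> gap z $ j" for z j
    using subgradient_row[OF P, of j z] by (simp add: gap_def matrix_vector_mul_component)
  \<comment> \<open>Stationarity cancels the linear part, so the weighted gap is the increment of
    the functional \<open>m\<close> in one step.\<close>
  have mgap: "m \<bullet> gap z = m \<bullet> f z - m \<bullet> z" for z
    using m(2) by (simp add: gap_def inner_diff_right flip: dot_lmul_matrix)
  have mono_m: "m \<bullet> z \<le> m \<bullet> f z" for z
  proof -
    have "0 \<le> m \<bullet> gap z" using m(1) gap0 by (simp add: inner_vec_def sum_nonneg)
    then show ?thesis by (simp add: mgap)
  qed
  then have "incseq (\<lambda>k. m \<bullet> (f ^^ k) x)" by (intro incseq_SucI) simp
  moreover obtain B where "\<And>k. norm ((f ^^ k) x) \<le> B"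
    using bounded_orbit[of x] by (auto simp: bounded_iff)
  then have "m \<bullet> (f ^^ k) x \<le> norm m * B" for k
    using norm_cauchy_schwarz[of m "(f ^^ k) x"] by (meson mult_left_mono norm_ge_zero order_trans)
  ultimately obtain L where L: "(\<lambda>k. m \<bullet> (f ^^ k) x) \<longlonglongrightarrow> L"
    using incseq_convergent[of "\<lambda>k. m \<bullet> (f ^^ k) x" "norm m * B"] by blast
  have const: "m \<bullet> z = L" if z: "z \<in> limit_points (\<lambda>k. (f ^^ k) x)" for z
  proof -
    obtain r where r: "strict_mono r" "(\<lambda>k. (f ^^ r k) x) \<longlonglongrightarrow> z"
      using z by (auto simp: limit_points_def)
    have "(\<lambda>k. m \<bullet> (f ^^ r k) x) \<longlonglongrightarrow> m \<bullet> z" using r(2) by (intro tendsto_intros)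
    moreover have "(\<lambda>k. m \<bullet> (f ^^ r k) x) \<longlonglongrightarrow> L"
      using LIMSEQ_subseq_LIMSEQ[OF L r(1)] by (simp add: comp_def)
    ultimately show ?thesis by (rule LIMSEQ_unique)
  qed
  have "m \<bullet> gap y = 0" using const[OF y] const[OF map_limit_points[OF y]] by (simp add: mgap)
  then have "\<forall>j. m $ j * gap y $ j = 0"
    using m(1) gap0 unfolding inner_vec_def inner_real_def by (subst (asm) sum_nonneg_eq_0_iff) auto
  then have "gap y $ i = 0" using m(3) by (metis less_irrefl mult_eq_0_iff)
  then show ?thesis by (simp add: gap_def matrix_vector_mul_component)
qed

text \<open>The maximum \<open>M\<close> of \<open>\<sigma> (f\<^sup>c(y)\<^sub>i - y\<^sub>i)\<close> propagates backwards in time along critical arcs. A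
  critical node lies on circuits of all large lengths divisible by \<open>c\<close>, so along a backward orbit
  its coordinate drifts by \<open>M\<close> every \<open>c\<close> steps, which boundedness allows only if \<open>M \<le> 0\<close>.\<close>

lemma cyclicity_drift_le_0:
  fixes \<sigma> :: real
  assumes c: "c = cyclicity f v" and y: "y \<in> limit_points (\<lambda>k. (f ^^ k) x)"
    and i: "i \<in> critical_nodes f v"
  shows "\<sigma> * ((f ^^ c) y $ i - y $ i) \<le> 0"
proof -
  let ?L = "limit_points (\<lambda>k. (f ^^ k) x)" and ?C = "critical_nodes f v" and ?E = "critical_arcs f v"
  have compL: "compact ?L" by (rule compact_limit_points[OF bounded_orbit])
  \<comment> \<open>\<open>\<sigma>\<close> is later taken as 1 and -1, giving both
    inequalities.\<close>
  define \<delta> where "\<delta> y i = \<sigma> * ((f ^^ c) y $ i - y $ i)" for y i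
  have "continuous_on ?L (\<lambda>y. \<delta> y i)" for i
    unfolding \<delta>_def using continuous_on_subset[OF continuous_iterate] by (intro continuous_intros) auto
  then have "compact (\<Union>i\<in>?C. (\<lambda>y. \<delta> y i) ` ?L)"
    using compL by (intro compact_UN compact_continuous_image) auto
  moreover have "(\<Union>i\<in>?C. (\<lambda>y. \<delta> y i) ` ?L) \<noteq> {}" using y i by blast
  ultimately obtain M where M: "M \<in> (\<Union>i\<in>?C. (\<lambda>y. \<delta> y i) ` ?L)"
    and Mmax: "\<And>t. t \<in> (\<Union>i\<in>?C. (\<lambda>y. \<delta> y i) ` ?L) \<Longrightarrow> t \<le> M"
    using compact_attains_sup by metis
  have le: "\<delta> z j \<le> M" if "z \<in> ?L" "j \<in> ?C" for z j using that by (intro Mmax) blast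
  obtain y0 i0 where y0: "y0 \<in> ?L" and i0: "i0 \<in> ?C" and "\<delta> y0 i0 = M" using M by auto
  have "\<exists>w. w \<in> ?L \<and> f w = z" if "z \<in> ?L" for z
    using that limit_points_subset_image[of x] by blast
  then obtain p where p: "\<And>z. z \<in> ?L \<Longrightarrow> p z \<in> ?L \<and> f (p z) = z" by metis
  define Y where "Y k = (p ^^ k) y0" for k
  have YL: "Y k \<in> ?L" for k by (induction k) (auto simp: Y_def y0 p)
  have fY: "f (Y (Suc k)) = Y k" for k using p[OF YL[of k]] by (simp add: Y_def)
  have backward: "(f ^^ j) (Y (j + k)) = Y k" for j k
    by (induction j arbitrary: k) (simp_all add: fY funpow_swap1)
  have drift: "j \<in> ?C \<and> \<delta> (Y k) j = M" if "(i0, j) \<in> ?E ^^ k" for j k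
    using that
  proof (induction k arbitrary: j)
    case 0
    then show ?case using i0 \<open>\<delta> y0 i0 = M\<close> by (simp add: Y_def)
  next
    case (Suc k)
    then obtain l where l: "(i0, l) \<in> ?E ^^ k" "(l, j) \<in> ?E" by auto
    then have IH: "\<delta> (Y k) l = M" using Suc.IH by blast
    obtain P where P: "P \<in> subdifferential f v" "l \<in> final_nodes P" "P $ l $ j \<noteq> 0"
      using l(2) by (auto simp: critical_arcs_def mem_final_arcs_iff)
    define z where "z = \<sigma> *\<^sub>R ((f ^^ c) (Y (Suc k)) - Y (Suc k))"
    have zj: "z $ j = \<delta> (Y (Suc k)) j" for j by (simp add: z_def \<delta>_def)
    have iterL: "(f ^^ c) (Y (Suc k)) \<in> ?L" using YL[of "Suc k"]
      by (induction c) (auto simp: map_limit_points)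
    \<comment> \<open>\<open>Y (Suc k)\<close> and its \<open>c\<close>-th image both lie in the
      limit set, where coordinate \<open>l\<close> of \<open>f\<close> is affine with row
      \<open>P $ l\<close>; their difference is therefore averaged exactly by that row.\<close>
    have "(f ^^ c) (Y k) $ l = v $ l + (P $ l) \<bullet> ((f ^^ c) (Y (Suc k)) - v)"
      using affine_on_limit_points[OF iterL P(1,2)] fY[of k] by (metis funpow_swap1)
    moreover have "Y k $ l = v $ l + (P $ l) \<bullet> (Y (Suc k) - v)"
      using affine_on_limit_points[OF YL[of "Suc k"] P(1,2)] fY[of k] by simp
    ultimately have "M = (P $ l) \<bullet> z"
      using IH by (simp add: \<delta>_def z_def inner_diff_right)
    moreover have inC: "j' \<in> ?C" if "P $ l $ j' \<noteq> 0" for j'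
    proof -
      have "(l, j') \<in> ?E" using P that by (auto simp: critical_arcs_def mem_final_arcs_iff)
      then show ?thesis using critical_arcs_subset by blast
    qed
    ultimately have "z $ j = M"
      using P(3) le[OF YL[of "Suc k"]]
      by (intro stochastic_inner_eq_max[OF subdifferential_stochastic[OF P(1), of l]]) (auto simp: zj)
    then show ?case using inC[OF P(3)] by (simp add: zj)
  qed
  obtain K where K: "K \<in> graph_classes ?C ?E" "i0 \<in> K" using i0 Union_graph_classes[of ?C ?E] by blast
  have "class_cyclicity ?E K dvd c"
    unfolding c cyclicity_def graph_cyclicity_def using K(1) by (intro dvd_Lcm) auto
  then obtain R where R: "\<And>r. R \<le> r \<Longrightarrow> (i0, i0) \<in> ?E ^^ (r * c)"
    using circuits_of_large_length[OF K] by blast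
  \<comment> \<open>A circuit of length \<open>Suc r * c\<close> brings the maximal drift back to
    \<open>i0\<close> at that backward time.\<close>
  have step: "\<sigma> * Y (r * c) $ i0 - \<sigma> * Y (Suc r * c) $ i0 = M" if "R \<le> r" for r
  proof -
    have "\<delta> (Y (Suc r * c)) i0 = M" using drift R[of "Suc r"] that by simp
    moreover have "(f ^^ c) (Y (Suc r * c)) = Y (r * c)" using backward[of c "r * c"] by simp
    ultimately show ?thesis by (simp add: \<delta>_def algebra_simps)
  qed
  have tele: "real n * M = \<sigma> * Y (R * c) $ i0 - \<sigma> * Y ((R + n) * c) $ i0" for n
  proof (induction n)
    case (Suc n)
    then show ?case using step[of "R + n"] by (simp add: algebra_simps)
  qed simp
  obtain B where B: "\<And>z. z \<in> ?L \<Longrightarrow> norm z \<le> B"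
    using compact_imp_bounded[OF compL] by (auto simp: bounded_iff)
  have "\<bar>Y k $ i0\<bar> \<le> B" for k using B[OF YL[of k]] component_le_norm_cart[of "Y k" i0] by simp
  then have bd: "\<bar>\<sigma> * Y k $ i0\<bar> \<le> \<bar>\<sigma>\<bar> * B" for k by (simp add: abs_mult mult_left_mono)
  have "real n * M \<le> 2 * (\<bar>\<sigma>\<bar> * B)" for n
    using tele[of n] bd[of "R * c"] bd[of "(R + n) * c"] by (simp add: abs_le_iff)
  then have "M \<le> 0" by (meson not_le reals_Archimedean3)
  then show ?thesis using le[OF y i] by (simp add: \<delta>_def)
qed

text \<open>The maximal gap between \<open>f ^^ c\<close> and the identity, in either order, is
  attained at a critical coordinate, where there is no drift.\<close>

lemma cyclicity_period_on_limit_points: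
  assumes c: "c = cyclicity f v" and y: "y \<in> limit_points (\<lambda>k. (f ^^ k) x)"
  shows "(f ^^ c) y = y"
proof -
  let ?L = "limit_points (\<lambda>k. (f ^^ k) x)"
  have L: "compact ?L" "?L \<noteq> {}" "?L \<subseteq> f ` ?L"
    using compact_limit_points[OF bounded_orbit] y limit_points_subset_image by auto
  have cont: "continuous_on ?L (f ^^ c)" by (rule continuous_on_subset[OF continuous_iterate]) simp
  have eq: "(f ^^ c) z $ i = z $ i" if "z \<in> ?L" "i \<in> critical_nodes f v" for z i
    using cyclicity_drift_le_0[OF c that, of 1] cyclicity_drift_le_0[OF c that, of "-1"] by simp
  have comm: "(f ^^ c) (f z) = f ((f ^^ c) z)" for z by (simp add: funpow_swap1)
  have "(f ^^ c) y $ j \<le> y $ j" for j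
  proof -
    obtain z i where "z \<in> ?L" "i \<in> critical_nodes f v"
      "\<And>u j. u \<in> ?L \<Longrightarrow> (f ^^ c) u $ j - u $ j \<le> (f ^^ c) z $ i - z $ i"
      using maximal_gap_on_critical_nodes[OF L cont continuous_on_id comm] by (metis (no_types))
    from this(3)[OF y, of j] eq[OF this(1,2)] show ?thesis by simp
  qed
  moreover have "y $ j \<le> (f ^^ c) y $ j" for j
  proof -
    obtain z i where "z \<in> ?L" "i \<in> critical_nodes f v"
      "\<And>u j. u \<in> ?L \<Longrightarrow> u $ j - (f ^^ c) u $ j \<le> z $ i - (f ^^ c) z $ i"
      using maximal_gap_on_critical_nodes[OF L continuous_on_id cont _ comm] by (metis (no_types))
    from this(3)[OF y, of j] eq[OF this(1,2)] show ?thesis by simp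
  qed
  ultimately show ?thesis by (simp add: vec_eq_iff eq_iff)
qed

text \<open>The sequence comes close to a point fixed by \<open>f ^^ c\<close>, and nonexpansiveness
  keeps all later terms as close; one subsequential limit thus decides the whole sequence.\<close>

lemma convergent_iterates_cyclicity:
  assumes c: "c = cyclicity f v"
  shows "convergent (\<lambda>k. (f ^^ (k * c)) x)"
\<comment> \<open>For \<open>c = 0\<close> the sequence is constant; this spares a proof that the
  cyclicity is positive.\<close>
proof (cases "c = 0")
  case True
  then show ?thesis by (simp add: convergent_const)
next
  case False
  have "bounded (range (\<lambda>k. (f ^^ (k * c)) x))"
    by (rule bounded_subset[OF bounded_orbit]) auto
  then obtain y r where r: "strict_mono r" "(\<lambda>k. (f ^^ (r k * c)) x) \<longlonglongrightarrow> y"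
    by (rule limit_points_nonempty)
  have "strict_mono (\<lambda>k. r k * c)" using r(1) False by (simp add: strict_mono_def)
  then have "y \<in> limit_points (\<lambda>k. (f ^^ k) x)" using r(2) unfolding limit_points_def by blast
  then have per: "(f ^^ c) y = y" by (rule cyclicity_period_on_limit_points[OF c])
  have fixy: "(f ^^ (k * c)) y = y" for k by (induction k) (simp_all add: funpow_add per)
  have "(\<lambda>k. (f ^^ (k * c)) x) \<longlonglongrightarrow> y"
  proof (intro vec_tendstoI LIMSEQ_I)
    fix i and e :: real assume "0 < e"
    then obtain n where "norm ((f ^^ (r n * c)) x - y) < e"
      using LIMSEQ_D[OF r(2)] by blast
    then have near: "\<bar>(f ^^ (r n * c)) x $ j - y $ j\<bar> \<le> norm ((f ^^ (r n * c)) x - y)" for j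
      using component_le_norm_cart[of "(f ^^ (r n * c)) x - y" j] by simp
    have "norm ((f ^^ (k * c)) x $ i - y $ i) < e" if k: "r n \<le> k" for k
    proof -
      obtain l where l: "k = l + r n" using k le_Suc_ex by (metis add.commute)
      let ?d = "norm ((f ^^ (r n * c)) x - y)" and ?z = "(f ^^ (r n * c)) x"
      have it: "(f ^^ (k * c)) x = (f ^^ (l * c)) ?z" by (simp add: l algebra_simps funpow_add)
      have "(f ^^ (l * c)) ?z $ i \<le> ?d + (f ^^ (l * c)) y $ i"
        by (rule iterate_shift_le) (use near in \<open>simp add: abs_le_iff algebra_simps\<close>)
      moreover have "(f ^^ (l * c)) y $ i \<le> ?d + (f ^^ (l * c)) ?z $ i"
        by (rule iterate_shift_le) (use near in \<open>simp add: abs_le_iff algebra_simps\<close>)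
      ultimately have "\<bar>(f ^^ (k * c)) x $ i - y $ i\<bar> \<le> ?d" by (simp add: it fixy abs_le_iff)
      then show ?thesis using \<open>?d < e\<close> by simp
    qed
    then show "\<exists>no. \<forall>k\<ge>no. norm ((f ^^ (k * c)) x $ i - y $ i) < e" by blast
  qed
  then show ?thesis by (rule convergentI)
qed

end

section \<open>Normalisation of the eigenvalue and assembly\<close>

theorem theorem1p1:
  fixes f :: "real ^ 'n::finite \<Rightarrow> real ^ 'n" and v :: "real ^ 'n" and lam :: real
    and C :: "'n set" and c :: nat and Ec :: "(real ^ 'n) set"
  assumes "convex_map f" and "mono f" and "homogeneous f"
    and "f v = vec lam + v"
    and "C = critical_nodes f v"
    and "c = cyclicity f v"
    and "Ec = restriction C ` eigenspace f lam"
  shows "monotone_homogeneous_iso UNIV C (eigenspace f lam) Ec (restriction C) \<and>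
         inf_subsemilattice C Ec \<and>
         (convex Ec \<and> aff_dim Ec \<le> int (card (critical_classes f v)) \<and>
           (piecewise_affine f \<longrightarrow> aff_dim Ec = int (card (critical_classes f v)))) \<and>
         (\<forall>x. convergent (\<lambda>k. (f ^^ (k * c)) x - vec (real (k * c) * lam)))"
proof -
  \<comment> \<open>Differences of values are unchanged, hence so are the subdifferential and the
    critical graph.\<close>
  define g where "g x = f x - vec lam" for x
  have sub: "subdifferential g v = subdifferential f v"
    by (simp add: subdifferential_def g_def)
  have graph: "critical_nodes g v = C" "critical_arcs g v = critical_arcs f v"
    using assms(5) by (simp_all add: critical_nodes_def critical_arcs_def sub)
  then have classes: "critical_classes g v = critical_classes f v" and cyc: "c = cyclicity g v"
    using assms(5,6) by (simp_all add: critical_classes_def cyclicity_def)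
  have E: "eigenspace f lam = {x. g x = x}"
    by (auto simp: eigenspace_def g_def algebra_simps)
  interpret convex_mh_fixed g v
  proof
    show "convex_map g" unfolding convex_map_def
    proof
      fix i
      have "convex_on UNIV (\<lambda>x. f x $ i + - lam)"
        using assms(1) by (intro convex_on_add) (auto simp: convex_map_def convex_on_const)
      then show "convex_on UNIV (\<lambda>x. g x $ i)" by (simp add: g_def)
    qed
    show "mono g" using assms(2) by (auto simp: mono_def g_def)
    show "homogeneous g" using assms(3) by (auto simp: homogeneous_def g_def)
    show "g v = v" using assms(4) by (simp add: g_def)
  qed
  have Ec: "Ec = restriction C ` {x. g x = x}" using assms(7) by (simp add: E)
  let ?h = "inv_into {x. g x = x} (restriction C)"
  \<comment> \<open>Reflecting the order yields injectivity by antisymmetry and, later, monotonicity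
    of the inverse.\<close>
  have le: "x \<le> y" if "g x = x" "g y = y" "restriction C x \<le> restriction C y" for x y
  proof (rule fixed_points_le_if_le_on_critical_nodes[OF that(1,2)])
    show "x $ i \<le> y $ i" if "i \<in> critical_nodes g v" for i
      using \<open>restriction C x \<le> restriction C y\<close> that graph(1)
      by (auto simp: less_eq_vec_def restriction_def dest: spec[of _ i])
  qed
  have inj: "inj_on (restriction C) {x. g x = x}"
    using le by (intro inj_onI antisym) auto
  have h: "g (?h y) = ?h y" "restriction C (?h y) = y" if "y \<in> Ec" for y
    using that inv_into_into[of y "restriction C" "{x. g x = x}"]
    by (auto simp: Ec f_inv_into_f)
  have shift: "g (add_scalar UNIV t x) = add_scalar UNIV t x" if "g x = x" for t x
    using that homogeneous by (simp add: add_scalar_UNIV homogeneous_def)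
  have rshift: "restriction C (add_scalar UNIV t x) = add_scalar C t (restriction C x)" for t x
    by (simp add: restriction_def add_scalar_def vec_eq_iff)
  have "monotone_homogeneous_iso UNIV C {x. g x = x} Ec (restriction C)"
    unfolding monotone_homogeneous_iso_def monotone_homogeneous_on_def
  proof (intro conjI exI[of _ ?h])
    show "{x. g x = x} \<subseteq> coord_space UNIV" by (simp add: coord_space_UNIV)
    show "Ec \<subseteq> coord_space C" by (auto simp: Ec restriction_mem)
    show "restriction C ` {x. g x = x} \<subseteq> Ec" by (simp add: Ec)
    show "mono_on {x. g x = x} (restriction C)"
      by (auto simp: mono_on_def restriction_def less_eq_vec_def)
    show "\<forall>x\<in>{x. g x = x}. \<forall>c. add_scalar UNIV c x \<in> {x. g x = x} \<longrightarrow>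
        restriction C (add_scalar UNIV c x) = add_scalar C c (restriction C x)"
      by (simp add: rshift)
    show "?h ` Ec \<subseteq> {x. g x = x}" using h(1) by auto
    show "mono_on Ec ?h"
    proof (rule mono_onI)
      fix y z assume y: "y \<in> Ec" and z: "z \<in> Ec" and "y \<le> z"
      then have "restriction C (?h y) \<le> restriction C (?h z)" by (simp only: h(2))
      with h(1)[OF y] h(1)[OF z] show "?h y \<le> ?h z" by (rule le)
    qed
    show "\<forall>y\<in>Ec. \<forall>c. add_scalar C c y \<in> Ec \<longrightarrow> ?h (add_scalar C c y) = add_scalar UNIV c (?h y)"
    proof (intro ballI allI impI)
      fix y t assume y: "y \<in> Ec" and ty: "add_scalar C t y \<in> Ec"
      have "restriction C (?h (add_scalar C t y)) = restriction C (add_scalar UNIV t (?h y))"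
        using h(2)[OF y] h(2)[OF ty] by (simp add: rshift)
      moreover have "?h (add_scalar C t y) \<in> {x. g x = x}" "add_scalar UNIV t (?h y) \<in> {x. g x = x}"
        by (rule CollectI, rule h(1)[OF ty]) (rule CollectI, rule shift[OF h(1)[OF y]])
      ultimately show "?h (add_scalar C t y) = add_scalar UNIV t (?h y)" by (rule inj_onD[OF inj])
    qed
    show "\<forall>x\<in>{x. g x = x}. ?h (restriction C x) = x" using inj by simp
    show "\<forall>y\<in>Ec. restriction C (?h y) = y" using h(2) by blast
  qed
  moreover have "inf_subsemilattice C Ec"
    using restriction_fixed_points_inf graph(1)
    by (auto simp: inf_subsemilattice_def Ec restriction_mem)
  moreover have "convex Ec"
    using restriction_fixed_points_convex by (simp add: Ec graph(1))
  moreover have dim: "aff_dim Ec \<le> int (card (critical_classes f v))"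
    using aff_dim_restriction_fixed_points_le by (simp add: Ec graph(1) classes)
  moreover have "aff_dim Ec = int (card (critical_classes f v))" if pa: "piecewise_affine f"
  proof -
    have "\<exists>A b. \<forall>x\<in>S. g x = A *v x + b" if affine: "\<exists>A b. \<forall>x\<in>S. f x = A *v x + b" for S
    proof -
      obtain A b where "\<forall>x\<in>S. f x = A *v x + b" using affine by blast
      then have "\<forall>x\<in>S. g x = A *v x + (b - vec lam)" by (simp add: g_def)
      then show ?thesis by blast
    qed
    then have "piecewise_affine g"
      using pa unfolding piecewise_affine_def by meson
    then show ?thesis
      using aff_dim_restriction_fixed_points_ge dim by (simp add: Ec graph(1) classes)
  qed
  moreover have "convergent (\<lambda>k. (f ^^ (k * c)) x - vec (real (k * c) * lam))" for x
  proof -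
    have "(g ^^ k) x = (f ^^ k) x - vec (real k * lam)" for k
    proof (induction k)
      case (Suc k)
      have "(g ^^ Suc k) x = g ((f ^^ k) x - vec (real k * lam))" using Suc by simp
      \<comment> \<open>Written as a translation so that homogeneity lets the accumulated constant
        pass through \<open>f\<close>.\<close>
      also have "(f ^^ k) x - vec (real k * lam) = vec (- (real k * lam)) + (f ^^ k) x"
        by (simp add: vec_eq_iff)
      also have "g \<dots> = vec (- (real k * lam)) + f ((f ^^ k) x) - vec lam"
        using assms(3) by (simp add: g_def homogeneous_def)
      finally show ?case by (simp add: vec_eq_iff algebra_simps)
    qed simp
    then show ?thesis using convergent_iterates_cyclicity[OF cyc, of x] by simp
  qed
  ultimately show ?thesis unfolding E by blast
qed

end
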